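(* Let $b\ge 2$, $c>1$, and let $\{Y_n\}_{n\ge 0}$ be the once-reinforced random walk with parameter $c$ on the tree ${\bf T}$. Let $S$ be its speed. Then for every $\epsilon$ with $0<\epsilon<S$, $$0<\liminf_{n\to\infty}\frac{-1}{n}\log {\bf P}\big(h(Y_n)\le (S-\epsilon)n\big)\le \limsup_{n\to\infty}\frac{-1}{n}\log {\bf P}\big(h(Y_n)\le (S-\epsilon)n\big)<\infty .$$
   Context: ${\bf T}$ is the infinite tree in which every vertex has $b+1$ neighbors, except one vertex, the root ${\bf 0}$, which has $b$ neighbors. $h(x)$ denotes the number of edges on the path from the root to the vertex $x$. Once-reinforced random walk with parameter $c>1$: $Y_0={\bf 0}$; every edge has initial weight $1$. Given the history up to time $i$, $Y_{i+1}$ is a neighbor of $Y_i$ chosen with probability proportional to the current weights of the edges incident to $Y_i$. An edge has weight $1$ as long as it has never been traversed, and weight $c$ from its first traversal (in either direction) on. Speed: it is known that for every $c>1$ there is a constant $S$ (depending on $c$ and $b$) with $0<S<b/(b+c)$ such that $\lim_{n\to\infty} h(Y_n)/n=S$ almost surely. *)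

theory Defs
  imports "HOL-Probability.Probability"
begin

text \<open>
  A vertex of the rooted tree is coded by the child labels met on the way to the root, most
  recent first: the root is \<open>[]\<close> and the children of \<open>x\<close> are \<open>i # x\<close> with \<open>i < b\<close>.
\<close>

definition tree_vertices :: "nat \<Rightarrow> nat list set" where
  "tree_vertices b = {x. set x \<subseteq> {..<b}}"

definition tree_nbrs :: "nat \<Rightarrow> nat list \<Rightarrow> nat list set" where
  "tree_nbrs b x = {y \<in> tree_vertices b. \<exists>i. y = i # x \<or> x = i # y}"

text \<open>The path from the root to \<open>x\<close> passes through the suffixes of \<open>x\<close>, one edge per label.\<close>

definition vertex_height :: "nat list \<Rightarrow> nat" where
  "vertex_height x = length x"

lemma tree_nbrs_Nil: "tree_nbrs b [] = (\<lambda>i. [i]) ` {..<b}"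
  by (auto simp: tree_nbrs_def tree_vertices_def)

lemma tree_nbrs_Cons:
  assumes "j # x \<in> tree_vertices b"
  shows "tree_nbrs b (j # x) = insert x ((\<lambda>i. i # j # x) ` {..<b})"
  using assms by (auto simp: tree_nbrs_def tree_vertices_def)

lemma finite_tree_nbrs: "x \<in> tree_vertices b \<Longrightarrow> finite (tree_nbrs b x)"
  by (cases x) (simp_all add: tree_nbrs_Nil tree_nbrs_Cons)

lemma card_tree_nbrs:
  assumes "x \<in> tree_vertices b"
  shows "card (tree_nbrs b x) = (if x = [] then b else b + 1)"
proof (cases x)
  case Nil
  then show ?thesis by (simp add: tree_nbrs_Nil card_image inj_on_def)
next
  case (Cons j y)
  have "y \<notin> (\<lambda>i. i # j # y) ` {..<b}"
  proof
    assume "y \<in> (\<lambda>i. i # j # y) ` {..<b}"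
    then obtain i where "y = i # j # y" by blast
    then have "length y = length (i # j # y)" by (rule arg_cong)
    then show False by simp
  qed
  then show ?thesis
    using assms Cons by (simp add: tree_nbrs_Cons card_image inj_on_def)
qed

text \<open>
  \<open>edge_weight c v n e\<close> is the weight at time \<open>n\<close> of the undirected edge \<open>e\<close> when the walk has
  followed \<open>v 0, \<dots>, v n\<close>.
\<close>

definition edge_weight :: "real \<Rightarrow> (nat \<Rightarrow> nat list) \<Rightarrow> nat \<Rightarrow> nat list set \<Rightarrow> real" where
  "edge_weight c v n e = (if \<exists>i<n. {v i, v (Suc i)} = e then c else 1)"

definition step_prob :: "nat \<Rightarrow> real \<Rightarrow> (nat \<Rightarrow> nat list) \<Rightarrow> nat \<Rightarrow> nat list \<Rightarrow> real" where
  "step_prob b c v n y =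
     (if y \<in> tree_nbrs b (v n)
      then edge_weight c v n {v n, y} / (\<Sum>z\<in>tree_nbrs b (v n). edge_weight c v n {v n, z})
      else 0)"

locale once_reinforced_walk = prob_space M for M :: "'w measure" +
  fixes b :: nat and c :: real and Y :: "nat \<Rightarrow> 'w \<Rightarrow> nat list"
  assumes measurable_walk: "\<And>n. Y n \<in> measurable M (count_space UNIV)"
    and start: "AE \<omega> in M. Y 0 \<omega> = []"
    and step: "\<And>n v y. \<P>(\<omega> in M. \<forall>i\<le>n. Y i \<omega> = v i) > 0 \<Longrightarrow>
      \<P>(\<omega> in M. Y (Suc n) \<omega> = y \<bar> \<forall>i\<le>n. Y i \<omega> = v i) = step_prob b c v n y"

definition has_speed :: "'w measure \<Rightarrow> (nat \<Rightarrow> 'w \<Rightarrow> nat list) \<Rightarrow> real \<Rightarrow> bool" where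
  "has_speed M Y S \<longleftrightarrow> (AE \<omega> in M. (\<lambda>n. real (vertex_height (Y n \<omega>)) / real n) \<longlonglongrightarrow> S)"

text \<open>
  The library has \<open>ln 0 = 0\<close>; here the logarithm of probability zero must be \<open>-\<infinity>\<close>.
\<close>

definition elog :: "real \<Rightarrow> ereal" where
  "elog p = (if p \<le> 0 then -\<infinity> else ereal (ln p))"

end

theory Submission
  imports Defs
begin

text \<open>
  Upper bound on the rate: oscillating along one edge has probability at least
  \<open>(1 / (c (b + 1))) ^ n\<close>.

  Lower bound. Positive speed makes the walk transient, so a walk at a newly visited vertex has a
  probability at least \<open>\<beta> > 0\<close> of never visiting the parent. From any state, whatever its past, a
  new vertex is found before the parent with probability at least \<open>1 / (1 + c)\<close>, so descending
  \<open>k\<close> levels has probability at most \<open>q ^ k\<close> with \<open>q < 1\<close>. Summing \<open>lam ^ j\<close> times the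
  probability of ever visiting level \<open>j\<close> gives, for \<open>q < lam < 1\<close>, a Lyapunov function
  comparable to \<open>lam ^ height\<close>; hence hitting times of higher levels have exponential moments,
  uniformly in the past.

  To reach the sharp constant \<open>1 / S\<close>, look at the first visit to level \<open>m\<close>. With probability at
  least \<open>\<beta>\<close> the walk never leaves the subtree below this vertex, and there it behaves like a walk
  from the root, for which the speed bounds the time to climb \<open>L\<close> levels by nearly \<open>L / S\<close>. If it
  does leave, a new attempt starts a bounded number of levels higher. So for large \<open>L\<close> climbing \<open>L\<close>
  levels takes longer than nearly \<open>L / S\<close> only with small conditional probability. With the
  exponential moments this bounds the moment generating function of the time per block of \<open>L\<close>
  levels, and blocks multiply. Finally, a walk that was high but is low at time \<open>n\<close> must have
  descended by a multiple of \<open>n\<close> levels.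
\<close>

lemma tendsto_0_sandwich:
  fixes f g :: "nat \<Rightarrow> real"
  assumes "\<And>n. f n \<le> g n" "g \<longlonglongrightarrow> 0" "\<And>n. 0 \<le> f n"
  shows "f \<longlonglongrightarrow> 0"
  using assms by (intro tendsto_sandwich[of "\<lambda>_. 0" f sequentially g 0]) auto

section \<open>The Markov chain of visited set and position\<close>

locale reinforced_tree =
  fixes b :: nat and c :: real
  assumes b_ge_2: "2 \<le> b" and c_gt_1: "1 < c"
begin

definition wt :: "nat list set \<Rightarrow> nat list \<Rightarrow> real" where
  "wt V x = (if x \<in> V then c else 1)"

text \<open>The parent edge always counts with weight \<open>c\<close>: the walk can stand at a
  non-root vertex only after having crossed that edge.\<close>

definition total_wt :: "nat list set \<Rightarrow> nat list \<Rightarrow> real" where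
  "total_wt V y = (if y = [] then 0 else c) + (\<Sum>i<b. wt V (i # y))"

text \<open>
  An edge of the tree is the parent edge of a unique non-root vertex, and it has been traversed
  iff that vertex has been visited. So the visited non-root vertices \<open>V\<close> together with the
  position \<open>y\<close> form a Markov chain; \<open>avg\<close> is its one-step transition operator.
\<close>

definition avg :: "(nat list set \<Rightarrow> nat list \<Rightarrow> real) \<Rightarrow> nat list set \<Rightarrow> nat list \<Rightarrow> real" where
  "avg f V y = ((if y = [] then 0 else c * f V (tl y)) +
     (\<Sum>i<b. wt V (i # y) * f (insert (i # y) V) (i # y))) / total_wt V y"

definition nxt :: "nat list set \<Rightarrow> nat list \<Rightarrow> nat list set \<Rightarrow> nat list \<Rightarrow> bool" where
  "nxt V y V' y' \<longleftrightarrow> (y \<noteq> [] \<and> V' = V \<and> y' = tl y) \<or> (\<exists>i<b. V' = insert (i # y) V \<and> y' = i # y)"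

lemma wt_ge_1: "1 \<le> wt V x" and wt_le_c: "wt V x \<le> c"
  using c_gt_1 by (auto simp: wt_def)

lemma sum_wt_ge: "real b \<le> (\<Sum>i<b. wt V (i # y))"
proof -
  have "(\<Sum>i<b. (1::real)) \<le> (\<Sum>i<b. wt V (i # y))" by (intro sum_mono wt_ge_1)
  then show ?thesis by simp
qed

lemma total_wt_ge: "real b \<le> total_wt V y"
  using sum_wt_ge[where V=V and y=y] c_gt_1 by (auto simp: total_wt_def)

lemma total_wt_pos: "0 < total_wt V y"
  using total_wt_ge[where V=V and y=y] b_ge_2 by linarith

lemma total_wt_le: "total_wt V y \<le> c * (real b + 1)"
proof -
  have "(\<Sum>i<b. wt V (i # y)) \<le> (\<Sum>i<b. c)" by (intro sum_mono wt_le_c)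
  then show ?thesis using c_gt_1 by (auto simp: total_wt_def algebra_simps)
qed

lemma avg_mono:
  assumes "\<And>V' y'. nxt V y V' y' \<Longrightarrow> f V' y' \<le> g V' y'"
  shows "avg f V y \<le> avg g V y"
proof -
  have "wt V x \<ge> 0" for x using wt_ge_1[where V=V and x=x] by linarith
  then show ?thesis unfolding avg_def using assms c_gt_1 total_wt_pos[where V=V and y=y]
    by (intro divide_right_mono add_mono sum_mono mult_left_mono) (auto simp: nxt_def)
qed

lemma avg_cong:
  assumes "\<And>V' y'. nxt V y V' y' \<Longrightarrow> f V' y' = g V' y'"
  shows "avg f V y = avg g V y"
  using assms by (intro antisym avg_mono) auto

lemma avg_const [simp]: "avg (\<lambda>_ _. k) V y = k"
proof -
  have "avg (\<lambda>_ _. k) V y = k * total_wt V y / total_wt V y"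
    by (simp add: avg_def total_wt_def sum_distrib_left algebra_simps)
  then show ?thesis using total_wt_pos[where V=V and y=y] by simp
qed

lemma avg_add: "avg (\<lambda>V y. f V y + g V y) V y = avg f V y + avg g V y"
  by (simp add: avg_def algebra_simps sum.distrib add_divide_distrib)

lemma avg_cmult: "avg (\<lambda>V y. k * f V y) V y = k * avg f V y"
  by (simp add: avg_def algebra_simps sum_distrib_left)

lemma avg_diff: "avg (\<lambda>V y. f V y - g V y) V y = avg f V y - avg g V y"
  using avg_add[of f "\<lambda>V y. (-1) * g V y"] avg_cmult[of "-1" g] by simp

lemma avg_sum: "avg (\<lambda>V y. \<Sum>j\<in>J. f j V y) V y = (\<Sum>j\<in>J. avg (f j) V y)"
proof (cases "finite J")
  case True
  then show ?thesis
    by (induction J rule: finite_induct) (simp_all add: avg_add)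
qed simp

lemma avg_ge_child:
  assumes "\<And>V' y'. 0 \<le> f V' y'" and "i < b"
  shows "f (insert (i # y) V) (i # y) / (c * (real b + 1)) \<le> avg f V y"
proof -
  let ?g = "\<lambda>i. wt V (i # y) * f (insert (i # y) V) (i # y)"
  have nn: "0 \<le> ?g i" for i using wt_ge_1[where V=V and x="i # y"] assms(1) by (intro mult_nonneg_nonneg) auto
  have "f (insert (i # y) V) (i # y) \<le> ?g i"
    using wt_ge_1[where V=V and x="i # y"] assms(1)[of "insert (i # y) V" "i # y"]
      mult_right_mono[of 1 "wt V (i # y)" "f (insert (i # y) V) (i # y)"] by simp
  also have "\<dots> \<le> (\<Sum>i<b. ?g i)" using nn assms(2) by (intro member_le_sum) auto
  also have "\<dots> \<le> (if y = [] then 0 else c * f V (tl y)) + (\<Sum>i<b. ?g i)"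
    using assms(1) c_gt_1 by auto
  finally have le: "f (insert (i # y) V) (i # y) \<le> \<dots>" .
  have "f (insert (i # y) V) (i # y) / (c * (real b + 1)) \<le> f (insert (i # y) V) (i # y) / total_wt V y"
    using assms(1) total_wt_le total_wt_pos c_gt_1 by (intro divide_left_mono mult_pos_pos) auto
  also have "\<dots> \<le> avg f V y" unfolding avg_def
    using le total_wt_pos[where V=V and y=y] by (intro divide_right_mono) auto
  finally show ?thesis .
qed

lemma avg_ge_parent:
  assumes "\<And>V' y'. 0 \<le> f V' y'" and "y \<noteq> []"
  shows "f V (tl y) / (c * (real b + 1)) \<le> avg f V y"
proof -
  let ?g = "\<lambda>i. wt V (i # y) * f (insert (i # y) V) (i # y)"
  have nn: "0 \<le> ?g i" for i using wt_ge_1[where V=V and x="i # y"] assms(1) by (intro mult_nonneg_nonneg) auto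
  have "f V (tl y) \<le> c * f V (tl y)"
    using c_gt_1 assms(1)[of V "tl y"] mult_right_mono[of 1 c "f V (tl y)"] by simp
  also have "\<dots> \<le> (if y = [] then 0 else c * f V (tl y)) + (\<Sum>i<b. ?g i)"
    using assms(2) nn by (auto intro: sum_nonneg)
  finally have le: "f V (tl y) \<le> \<dots>" .
  have "f V (tl y) / (c * (real b + 1)) \<le> f V (tl y) / total_wt V y"
    using assms(1) total_wt_le total_wt_pos c_gt_1 by (intro divide_left_mono mult_pos_pos) auto
  also have "\<dots> \<le> avg f V y" unfolding avg_def
    using le total_wt_pos[where V=V and y=y] by (intro divide_right_mono) auto
  finally show ?thesis .
qed

text \<open>
  For the chain started at \<open>(V, y)\<close>, \<open>surv A n V y\<close> is the probability that the heights at times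
  \<open>0, \<dots>, n\<close> are all in \<open>A\<close>, and \<open>mass A n V y\<close> that the height at time \<open>n\<close> is in \<open>A\<close>.
\<close>

primrec surv :: "nat set \<Rightarrow> nat \<Rightarrow> nat list set \<Rightarrow> nat list \<Rightarrow> real" where
  "surv A 0 = (\<lambda>V y. if length y \<in> A then 1 else 0)"
| "surv A (Suc n) = (\<lambda>V y. if length y \<in> A then avg (surv A n) V y else 0)"

primrec mass :: "nat set \<Rightarrow> nat \<Rightarrow> nat list set \<Rightarrow> nat list \<Rightarrow> real" where
  "mass A 0 = (\<lambda>V y. if length y \<in> A then 1 else 0)"
| "mass A (Suc n) = avg (mass A n)"

text \<open>Heights change by one per step, so from a start above level \<open>j\<close> this is the
  probability of a visit to level \<open>j\<close> by time \<open>n\<close>. From a start at or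
  below \<open>j\<close> it is 1.\<close>

abbreviation hit :: "nat \<Rightarrow> nat \<Rightarrow> nat list set \<Rightarrow> nat list \<Rightarrow> real" where
  "hit j n V y \<equiv> 1 - surv {j<..} n V y"

lemma surv_bounds: "0 \<le> surv A n V y \<and> surv A n V y \<le> 1"
proof (induction n arbitrary: V y)
  case (Suc n)
  have "avg (\<lambda>_ _. 0) V y \<le> avg (surv A n) V y" "avg (surv A n) V y \<le> avg (\<lambda>_ _. 1) V y"
    by (rule avg_mono; use Suc in blast)+
  then show ?case by simp
qed simp

lemmas surv_nonneg [simp] = surv_bounds[THEN conjunct1] and surv_le_1 [simp] = surv_bounds[THEN conjunct2]

lemma surv_notin: "length y \<notin> A \<Longrightarrow> surv A n V y = 0"
  by (cases n) auto

lemma mass_nonneg: "0 \<le> mass A n V y"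
proof (induction n arbitrary: V y)
  case (Suc n)
  have "avg (\<lambda>_ _. 0) V y \<le> avg (mass A n) V y"
    by (rule avg_mono) (use Suc in blast)
  then show ?case by simp
qed simp

lemma surv_mono_set: "A \<subseteq> B \<Longrightarrow> surv A n V y \<le> surv B n V y"
proof (induction n arbitrary: V y)
  case (Suc n)
  then show ?case by (auto intro!: avg_mono simp: surv_notin)
      (metis avg_const avg_mono surv_nonneg)
qed auto

lemma surv_Suc_le: "surv A (Suc n) V y \<le> surv A n V y"
proof (induction n arbitrary: V y)
  case 0
  have "avg (surv A 0) V y \<le> 1" using surv_le_1[of A 0] avg_mono[of V y "surv A 0" "\<lambda>_ _. 1"] by simp
  then show ?case by auto
next
  case (Suc n)
  have "avg (surv A (Suc n)) V y \<le> avg (surv A n) V y" by (rule avg_mono) (rule Suc)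
  then show ?case by simp
qed

lemma surv_antimono: "n \<le> m \<Longrightarrow> surv A m V y \<le> surv A n V y"
  using lift_Suc_antimono_le[of "\<lambda>n. surv A n V y"] surv_Suc_le by blast

lemma surv_le_mass: "surv A n V y \<le> mass A n V y"
proof (induction n arbitrary: V y)
  case (Suc n)
  have "avg (surv A n) V y \<le> avg (mass A n) V y" by (rule avg_mono) (rule Suc)
  then show ?case using mass_nonneg[of A "Suc n" V y] by simp
qed simp

text \<open>Together with \<open>good\<close> this is the invariant of reachable states:
  \<open>V\<close> and the root form a finite subtree containing the position. The root is left out
  of \<open>V\<close> because it has no parent edge.\<close>

definition tree :: "nat list set \<Rightarrow> bool" where
  "tree V \<longleftrightarrow> finite V \<and> [] \<notin> V \<and> (\<forall>a x. a # x \<in> V \<longrightarrow> a < b \<and> (x = [] \<or> x \<in> V))"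

definition good :: "nat list set \<Rightarrow> nat list \<Rightarrow> bool" where
  "good V y \<longleftrightarrow> tree V \<and> (y = [] \<or> y \<in> V)"

lemma tree_insert: "tree V \<Longrightarrow> y = [] \<or> y \<in> V \<Longrightarrow> i < b \<Longrightarrow> tree (insert (i # y) V)"
  by (auto simp: tree_def)

lemma tree_tl: "tree V \<Longrightarrow> y \<in> V \<Longrightarrow> tl y = [] \<or> tl y \<in> V"
  by (cases y) (auto simp: tree_def)

lemma good_nxt: "good V y \<Longrightarrow> nxt V y V' y' \<Longrightarrow> good V' y'"
  using tree_tl by (auto simp: good_def nxt_def tree_insert)

lemma good_start: "good {} []" by (simp add: good_def tree_def)

lemma tree_append: "tree V \<Longrightarrow> z @ x \<in> V \<Longrightarrow> x \<noteq> [] \<Longrightarrow> x \<in> V"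
  by (induction z) (auto simp: tree_def)

text \<open>Until it leaves the subtree of \<open>x\<close>, the walk sees only weights of edges
  inside the subtree and the parent edge of \<open>x\<close>, which weighs \<open>c\<close> for
  every non-root \<open>x\<close>. So survival events in relative height agree for two subtrees with
  the same visited pattern.\<close>

lemma surv_selfsim:
  assumes "x \<noteq> []" "x' \<noteq> []" "\<And>z. z @ x \<in> V \<longleftrightarrow> z @ x' \<in> V'"
  shows "surv {k. length x \<le> k \<and> k - length x \<in> B} n V (z @ x) =
         surv {k. length x' \<le> k \<and> k - length x' \<in> B} n V' (z @ x')"
  using assms(3)
proof (induction n arbitrary: V V' z)
  case (Suc n)
  let ?A = "{k. length x \<le> k \<and> k - length x \<in> B}" and ?A' = "{k. length x' \<le> k \<and> k - length x' \<in> B}"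
  have w: "wt V (i # z @ x) = wt V' (i # z @ x')" for i
    using Suc.prems[of "i # z"] by (simp add: wt_def)
  have tot: "total_wt V (z @ x) = total_wt V' (z @ x')"
    using assms(1,2) by (simp add: total_wt_def w)
  have child: "surv ?A n (insert (i # z @ x) V) (i # z @ x) = surv ?A' n (insert (i # z @ x') V') (i # z @ x')" for i
  proof -
    have "z' @ x = i # z @ x \<longleftrightarrow> z' = i # z" "z' @ x' = i # z @ x' \<longleftrightarrow> z' = i # z" for z'
      using append_same_eq[of z' x "i # z"] append_same_eq[of z' x' "i # z"] by auto
    then have "\<And>z'. z' @ x \<in> insert (i # z @ x) V \<longleftrightarrow> z' @ x' \<in> insert (i # z @ x') V'"
      using Suc.prems by auto
    from Suc.IH[OF this, of "i # z"] show ?thesis by simp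
  qed
  have parent: "surv ?A n V (tl (z @ x)) = surv ?A' n V' (tl (z @ x'))"
  proof (cases z)
    case Nil
    \<comment> \<open>A parent step from the top of the subtree leaves the allowed heights on both
      sides, so both values are 0.\<close>
    then show ?thesis using assms(1,2) by (subst (1 2) surv_notin) (auto simp: neq_Nil_conv)
  next
    case (Cons a w)
    then show ?thesis using Suc.IH[OF Suc.prems, of w] by simp
  qed
  have "avg (surv ?A n) V (z @ x) = avg (surv ?A' n) V' (z @ x')"
    using assms(1,2) by (simp add: avg_def tot w child parent)
  then show ?case by simp
qed auto

section \<open>Escape probabilities\<close>

text \<open>Since \<open>surv\<close> decreases in \<open>n\<close>, a uniform lower bound means a
  positive probability of never visiting the root.\<close>

definition escaping :: "nat list set \<Rightarrow> nat list \<Rightarrow> bool" where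
  "escaping V y \<longleftrightarrow> (\<exists>\<eta>>0. \<forall>n. \<eta> \<le> surv {0<..} n V y)"

text \<open>Every single step has probability at least \<open>1 / (c * (b + 1))\<close>, so
  positivity of escape is inherited by the state before the step.\<close>

lemma escaping_backwards:
  assumes "y \<noteq> []" and "escaping V' y'"
    and "\<And>n. surv {0<..} n V' y' / (c * (real b + 1)) \<le> avg (surv {0<..} n) V y"
  shows "escaping V y"
proof -
  obtain \<eta> where \<eta>: "\<eta> > 0" "\<And>n. \<eta> \<le> surv {0<..} n V' y'" using assms(2) by (auto simp: escaping_def)
  let ?K = "c * (real b + 1)"
  have K: "?K > 0" using c_gt_1 by (intro mult_pos_pos) auto
  have "\<eta> / ?K \<le> surv {0<..} n V y" for n
  proof -
    have "\<eta> / ?K \<le> surv {0<..} n V' y' / ?K" using \<eta>(2) K by (intro divide_right_mono) auto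
    also have "\<dots> \<le> surv {0<..} (Suc n) V y" using assms(1) assms(3)[of n] by simp
    also have "\<dots> \<le> surv {0<..} n V y" by (rule surv_Suc_le)
    finally show ?thesis .
  qed
  moreover have "\<eta> / ?K > 0" using \<eta>(1) K by simp
  ultimately show ?thesis unfolding escaping_def by blast
qed

lemma escaping_child: "y \<noteq> [] \<Longrightarrow> i < b \<Longrightarrow> escaping (insert (i # y) V) (i # y) \<Longrightarrow> escaping V y"
  by (rule escaping_backwards[where V'="insert (i # y) V" and y'="i # y"]) (auto intro!: avg_ge_child)

lemma escaping_parent: "y \<noteq> [] \<Longrightarrow> escaping V (tl y) \<Longrightarrow> escaping V y"
  by (rule escaping_backwards[where V'=V and y'="tl y"]) (auto intro!: avg_ge_parent)

text \<open>The walk can climb from \<open>x\<close> to \<open>z @ x\<close> through vertices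
  visited before, which leaves \<open>V\<close> unchanged.\<close>

lemma escaping_ancestor:
  assumes "tree V" "x \<noteq> []"
  shows "z @ x \<in> V \<Longrightarrow> escaping V (z @ x) \<Longrightarrow> escaping V x"
proof (induction z)
  case (Cons a z)
  then have "a < b" "z @ x \<in> V" using assms by (auto simp: tree_def)
  moreover have "insert (a # z @ x) V = V" using Cons.prems by auto
  ultimately show ?case using Cons escaping_child[of "z @ x" a V] assms(2) by simp
qed simp

lemma escaping_descendant:
  assumes "x \<noteq> []" "escaping V x"
  shows "escaping V (z @ x)"
proof (induction z)
  case (Cons a z)
  then show ?case using escaping_parent[of "(a # z) @ x" V] by simp
qed (use assms in simp)

lemma surv_subtree:
  assumes "x \<noteq> []" "x' \<noteq> []" "\<And>z. z @ x \<in> V \<longleftrightarrow> z @ x' \<in> V'"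
  shows "surv {length x - 1<..} n V (z @ x) = surv {length x' - 1<..} n V' (z @ x')"
proof -
  have "{length u - 1<..} = {k. length u \<le> k \<and> k - length u \<in> UNIV}" if "u \<noteq> []" for u :: "nat list"
    using that by (cases u) auto
  then show ?thesis using surv_selfsim[OF assms(1-3), where B=UNIV] assms by simp
qed

lemma escaping_subtree:
  assumes "\<And>z. z @ [r] \<in> V \<longleftrightarrow> z @ [r'] \<in> V'"
  shows "escaping V (z @ [r]) \<longleftrightarrow> escaping V' (z @ [r'])"
  unfolding escaping_def using surv_subtree[of "[r]" "[r']" V V', OF _ _ assms] by simp

text \<open>
  The visited set can be built up within the subtree of \<open>z\<close> one deepest vertex at a time, without
  visiting the root, so escape from \<open>z\<close> propagates back to escape from a first child.
\<close>

lemma escaping_fresh: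
  assumes "tree V" "z \<in> V" "escaping V z"
  shows "escaping {[0]} [0]"
  using assms
proof (induction "card V" arbitrary: V z rule: less_induct)
  case less
  have fin: "finite V" and nonempty: "V \<noteq> {}" using less.prems by (auto simp: tree_def)
  obtain y' where y': "y' \<in> V" and mx: "\<And>x. x \<in> V \<Longrightarrow> length x \<le> length y'"
  proof -
    have "Max (length ` V) \<in> length ` V" using fin nonempty by (intro Max_in) auto
    then obtain u where "u \<in> V" "length u = Max (length ` V)" by auto
    then show ?thesis using that fin by simp
  qed
  have y'_ne: "y' \<noteq> []" and z_ne: "z \<noteq> []" using less.prems y' by (auto simp: tree_def)
  obtain i y where y'_eq: "y' = i # y" using y'_ne by (cases y') auto
  have ib: "i < b" and y: "y = [] \<or> y \<in> V" using less.prems(1) y' y'_eq by (auto simp: tree_def)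
  \<comment> \<open>A deepest vertex has no visited children, so removing it leaves a tree.\<close>
  define V0 where "V0 = V - {y'}"
  have tree0: "tree V0" using less.prems(1) mx unfolding tree_def V0_def by fastforce
  have smaller: "card V0 < card V" unfolding V0_def using fin y' by (rule card_Diff1_less)
  have ins: "insert (i # y) V0 = V" using y' y'_eq by (auto simp: V0_def)
  \<comment> \<open>The last label of a vertex names its branch at the root. If \<open>y'\<close>
    lies in another branch than \<open>z\<close>, its removal does not affect escape from
    \<open>z\<close>.\<close>
  show ?case
  proof (cases "last z = last y'")
    case False
    have "escaping V (butlast z @ [last z]) \<longleftrightarrow> escaping V0 (butlast z @ [last z])"
      by (rule escaping_subtree) (use False in \<open>auto simp: V0_def\<close>)
    then have "escaping V0 z" using less.prems z_ne by simp
    moreover have "z \<in> V0" using less.prems False by (auto simp: V0_def)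
    ultimately show ?thesis using less.hyps[OF smaller tree0] by blast
  next
    case same: True
    show ?thesis
    proof (cases "y = []")
      case True
      then have "length z \<le> 1" using mx[OF less.prems(2)] y'_eq by simp
      then have z: "z = [i]" using same z_ne y'_eq True by (cases z) auto
      have "w @ [i] \<in> V \<longleftrightarrow> w @ [0] \<in> {[0::nat]}" for w
        using mx[of "w @ [i]"] y' y'_eq True by auto
      from escaping_subtree[OF this, of "[]"] show ?thesis using less.prems z by simp
    next
      case False
      \<comment> \<open>In the same branch, escape passes from \<open>z\<close> to the first vertex
        of the branch, from there to \<open>y'\<close>, and then to \<open>y\<close> in
        \<open>V0\<close>, because stepping from \<open>y\<close> to \<open>y'\<close> restores
        \<open>V\<close>.\<close>
      have "butlast z @ [last z] = z" using z_ne by simp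
      then have "escaping V [last z]"
        using escaping_ancestor[OF less.prems(1), of "[last z]" "butlast z"] less.prems by simp
      then have "escaping V (butlast y' @ [last y'])"
        using escaping_descendant[of "[last z]"] same by simp
      then have "escaping V y'" using y'_ne by simp
      then have "escaping V0 y" using escaping_child[OF False ib, of V0] ins y'_eq by simp
      moreover have "y \<in> V0" using False y y'_eq by (auto simp: V0_def)
      ultimately show ?thesis using less.hyps[OF smaller tree0] by blast
    qed
  qed
qed

lemma surv_tendsto_0:
  assumes "\<not> escaping {[0]} [0]" "good V y"
  shows "(\<lambda>n. surv {0<..} n V y) \<longlonglongrightarrow> 0"
proof (cases "y = []")
  case True
  then show ?thesis by (simp add: surv_notin)
next
  case False
  then have "\<not> escaping V y" using assms escaping_fresh by (auto simp: good_def)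
  obtain l where l: "(\<lambda>n. surv {0<..} n V y) \<longlonglongrightarrow> l" "\<And>n. l \<le> surv {0<..} n V y"
    using decseq_convergent[of "\<lambda>n. surv {0<..} n V y" 0] surv_antimono by (auto simp: decseq_def)
  have "0 \<le> l" using l(1) by (rule LIMSEQ_le_const) auto
  moreover have "\<not> 0 < l" using l(2) \<open>\<not> escaping V y\<close> by (auto simp: escaping_def)
  ultimately show ?thesis using l(1) by simp
qed

lemma avg_tendsto:
  assumes "\<And>V' y'. nxt V y V' y' \<Longrightarrow> (\<lambda>m. f m V' y') \<longlonglongrightarrow> g V' y'"
  shows "(\<lambda>m. avg (f m) V y) \<longlonglongrightarrow> avg g V y"
proof -
  have "(\<lambda>m. if y = [] then 0 else c * f m V (tl y)) \<longlonglongrightarrow> (if y = [] then 0 else c * g V (tl y))"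
    using assms[of V "tl y"] by (cases "y = []") (auto simp: nxt_def intro: tendsto_mult_left)
  moreover have "(\<lambda>m. \<Sum>i<b. wt V (i # y) * f m (insert (i # y) V) (i # y))
      \<longlonglongrightarrow> (\<Sum>i<b. wt V (i # y) * g (insert (i # y) V) (i # y))"
    using assms by (intro tendsto_sum tendsto_mult_left) (auto simp: nxt_def)
  ultimately show ?thesis unfolding avg_def
    using total_wt_pos[where V=V and y=y] by (intro tendsto_divide tendsto_add) auto
qed

lemma avg_funpow_tendsto_0:
  assumes "\<And>V y. good V y \<Longrightarrow> (\<lambda>m. f m V y) \<longlonglongrightarrow> 0" "good V y"
  shows "(\<lambda>m. (avg ^^ N) (f m) V y) \<longlonglongrightarrow> 0"
  using assms(2)
proof (induction N arbitrary: V y)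
  case (Suc N)
  then have "(\<lambda>m. avg ((avg ^^ N) (f m)) V y) \<longlonglongrightarrow> avg (\<lambda>_ _. 0) V y"
    using good_nxt by (intro avg_tendsto) blast
  then show ?case by simp
qed (use assms in simp)

text \<open>Below a vertex without visited descendants the tree looks as it does below a first child
  just entered from the root.\<close>

lemma fresh_surv:
  assumes "y \<noteq> []" "y \<in> V" "\<And>z. z \<noteq> [] \<Longrightarrow> z @ y \<notin> V"
  shows "surv {length y - 1<..} n V y = surv {0<..} n {[0]} [0]"
    and "surv {length y - 1<..<length y + L} n V y = surv {0<..<Suc L} n {[0]} [0]"
proof -
  have rel: "z @ y \<in> V \<longleftrightarrow> z @ [0] \<in> {[0::nat]}" for z using assms by (cases "z = []") auto
  show "surv {length y - 1<..} n V y = surv {0<..} n {[0]} [0]"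
    using surv_subtree[of y "[0]" V "{[0]}", OF _ _ rel, of n "[]"] assms(1) by simp
  have "{length y - 1<..<length y + L} = {k. length y \<le> k \<and> k - length y \<in> {..<L}}"
    using assms(1) by (cases y) auto
  moreover have "{0<..<Suc L} = {k. length [0::nat] \<le> k \<and> k - length [0::nat] \<in> {..<L}}" by auto
  ultimately show "surv {length y - 1<..<length y + L} n V y = surv {0<..<Suc L} n {[0]} [0]"
    using surv_selfsim[of y "[0]" V "{[0]}", OF _ _ rel, of "{..<L}" n "[]"] assms(1) by simp
qed

section \<open>Probabilities of descending to a lower level\<close>

lemma hit_bounds [simp]: "0 \<le> hit j n V y" "hit j n V y \<le> 1"
  by simp_all

lemma hit_Suc: "j < length y \<Longrightarrow> hit j (Suc n) V y = avg (hit j n) V y"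
  by (simp add: avg_diff)

lemma hit_low: "length y \<le> j \<Longrightarrow> hit j n V y = 1"
  by (simp add: surv_notin)

text \<open>The probability of choosing the parent edge, of weight \<open>c\<close>, against one
  fresh edge of weight 1.\<close>

definition \<rho> :: real where "\<rho> = c / (1 + c)"

lemma rho: "0 < \<rho>" "\<rho> < 1" "c * (1 - \<rho>) = \<rho>" "1 < 2 * \<rho>"
  using c_gt_1 by (auto simp: \<rho>_def field_simps)

text \<open>
  Write \<open>k\<close> for the number of visited children. Until a new vertex is entered, \<open>\<rho> ^ height\<close> is a
  supermartingale if a new vertex is given the value \<open>0\<close>.
\<close>

lemma rho_supermartingale:
  assumes "k \<le> b"
  shows "c + real k * c * \<rho>\<^sup>2 \<le> \<rho> * (c + real k * c + (real b - real k))"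
proof -
  have "1 - real k * \<rho> \<le> real b - real k"
  proof (cases "k = b")
    case True
    have "2 * \<rho> \<le> real b * \<rho>" using b_ge_2 rho by (intro mult_right_mono) auto
    then have "1 \<le> real b * \<rho>" using rho by linarith
    then show ?thesis using True by simp
  next
    case False
    then have "real k + 1 \<le> real b" using assms by linarith
    moreover have "0 \<le> real k * \<rho>" using rho by simp
    ultimately show ?thesis by linarith
  qed
  then have "\<rho> * (1 - real k * \<rho>) \<le> \<rho> * (real b - real k)" using rho by (intro mult_left_mono) auto
  moreover have "c * (1 - \<rho>) * (1 - real k * \<rho>) = \<rho> * (1 - real k * \<rho>)" using rho by simp
  ultimately show ?thesis by (simp add: algebra_simps power2_eq_square)
qed

text \<open>The bound mixes, with weights \<open>1 - \<beta>\<close> and \<open>\<beta>\<close>, the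
  constant 1 and the supermartingale that is a power of \<open>\<rho>\<close> until a new vertex is
  found and 0 there. On finding a new vertex the bound \<open>1 - \<beta>\<close> is exactly the
  escape estimate.\<close>

lemma hit_le_rho:
  assumes esc: "\<And>n. \<beta> \<le> surv {0<..} n {[0]} [0]" and \<beta>: "0 \<le> \<beta>"
  shows "good V y \<Longrightarrow> j \<le> length y \<Longrightarrow> hit j n V y \<le> 1 - \<beta> + \<beta> * \<rho> ^ (length y - j)"
proof (induction n arbitrary: V y)
  case 0
  have "\<beta> \<le> 1" using esc[of 0] by simp
  have "0 \<le> \<beta> * \<rho> ^ (length y - j)" using \<beta> rho by simp
  then show ?case using 0 \<open>\<beta> \<le> 1\<close> by auto
next
  case (Suc n)
  show ?case
  proof (cases "length y = j")
    case True
    then show ?thesis by (simp add: surv_notin)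
  next
    case False
    then have jl: "j < length y" using Suc.prems by simp
    then obtain d where d: "length y - j = Suc d" by (metis Suc_diff_Suc)
    have y_ne: "y \<noteq> []" using jl by auto
    have tree: "tree V" using Suc.prems by (simp add: good_def)
    define I where "I = {i \<in> {..<b}. i # y \<in> V}"
    define k where "k = card I"
    have "k \<le> card {..<b}" unfolding k_def I_def by (intro card_mono) auto
    then have kb: "k \<le> b" by simp
    have sum_split: "(\<Sum>i<b. if i # y \<in> V then A else B) = real k * A + (real b - real k) * B" for A B :: real
    proof -
      have "card ({..<b} - I) = b - k" unfolding k_def I_def by (subst card_Diff_subset) auto
      moreover have "{..<b} \<inter> - {i. i # y \<in> V} = {..<b} - I" "{..<b} \<inter> {i. i # y \<in> V} = I" by (auto simp: I_def)
      ultimately show ?thesis using kb by (simp add: sum.If_cases k_def of_nat_diff)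
    qed
    have parent: "hit j n V (tl y) \<le> 1 - \<beta> + \<beta> * \<rho> ^ d"
    proof -
      have "nxt V y V (tl y)" using y_ne by (simp add: nxt_def)
      then have "good V (tl y)" using good_nxt Suc.prems by blast
      moreover have "length (tl y) - j = d" "j \<le> length (tl y)" using d jl by simp_all
      ultimately show ?thesis using Suc.IH[of V "tl y"] by simp
    qed
    have child: "wt V (i # y) * hit j n (insert (i # y) V) (i # y)
        \<le> (if i # y \<in> V then c * (1 - \<beta> + \<beta> * \<rho> ^ (d + 2)) else 1 - \<beta>)" if "i < b" for i
    proof (cases "i # y \<in> V")
      case True
      have "nxt V y (insert (i # y) V) (i # y)" using that by (auto simp: nxt_def)
      then have "good (insert (i # y) V) (i # y)" using good_nxt Suc.prems by blast
      moreover have "length (i # y) - j = d + 2" "j \<le> length (i # y)" using d jl by simp_all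
      ultimately have "hit j n (insert (i # y) V) (i # y) \<le> 1 - \<beta> + \<beta> * \<rho> ^ (d + 2)"
        using Suc.IH[of "insert (i # y) V" "i # y"] by simp
      then show ?thesis using True c_gt_1 by (simp add: wt_def)
    next
      case False
      \<comment> \<open>Since \<open>V\<close> is a tree, an unvisited \<open>i # y\<close> has no
        visited descendants. Hitting level \<open>j\<close> would require leaving its
        subtree.\<close>
      have "surv {length (i # y) - 1<..} n (insert (i # y) V) (i # y) = surv {0<..} n {[0]} [0]"
      proof (rule fresh_surv(1))
        fix z assume "z \<noteq> ([] :: nat list)"
        then have "z @ i # y \<noteq> i # y" by simp
        moreover have "z @ i # y \<notin> V" using tree_append[OF tree, of z "i # y"] False by auto
        ultimately show "z @ i # y \<notin> insert (i # y) V" by simp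
      qed auto
      moreover have "surv {length (i # y) - 1<..} n (insert (i # y) V) (i # y)
          \<le> surv {j<..} n (insert (i # y) V) (i # y)"
        using jl by (intro surv_mono_set) auto
      ultimately show ?thesis using esc[of n] False by (simp add: wt_def)
    qed
    have tot: "total_wt V y = c + real k * c + (real b - real k)"
      using y_ne sum_split[of c 1] by (simp add: total_wt_def wt_def)
    have "hit j (Suc n) V y * total_wt V y =
        c * hit j n V (tl y) + (\<Sum>i<b. wt V (i # y) * hit j n (insert (i # y) V) (i # y))"
      unfolding hit_Suc[OF jl] avg_def using y_ne total_wt_pos[where V=V and y=y] by simp
    also have "\<dots> \<le> c * (1 - \<beta> + \<beta> * \<rho> ^ d) +
        (\<Sum>i<b. if i # y \<in> V then c * (1 - \<beta> + \<beta> * \<rho> ^ (d + 2)) else 1 - \<beta>)"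
      using parent child c_gt_1 by (intro add_mono sum_mono mult_left_mono) auto
    \<comment> \<open>With the constant part split off, the rest is
      \<open>\<beta> * \<rho> ^ d\<close> times the left side of
      \<open>rho_supermartingale\<close>.\<close>
    also have "\<dots> = (1 - \<beta>) * total_wt V y + \<beta> * \<rho> ^ d * (c + real k * c * \<rho>\<^sup>2)"
      unfolding sum_split tot by (simp add: algebra_simps power2_eq_square)
    also have "\<dots> \<le> (1 - \<beta>) * total_wt V y + \<beta> * \<rho> ^ d * (\<rho> * total_wt V y)"
      unfolding tot using rho_supermartingale[OF kb] \<beta> rho by (intro add_left_mono mult_left_mono) auto
    also have "\<dots> = (1 - \<beta> + \<beta> * \<rho> ^ (length y - j)) * total_wt V y"
      unfolding d by (simp add: algebra_simps)
    finally show ?thesis using total_wt_pos[where V=V and y=y] by (simp del: surv.simps)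
  qed
qed

end

locale escaping_tree = reinforced_tree +
  fixes \<beta> :: real
  assumes \<beta>_pos: "0 < \<beta>" and escape: "\<And>n. \<beta> \<le> surv {0<..} n {[0]} [0]"
begin

lemma \<beta>_le_1: "\<beta> \<le> 1"
  using escape[of 0] by simp

text \<open>The bound of \<open>hit_le_rho\<close> for a descent by one level.\<close>

definition q :: real where "q = 1 - \<beta> * (1 - \<rho>)"

lemma q: "0 < q" "q < 1"
proof -
  have "\<beta> * (1 - \<rho>) \<le> 1 * (1 - \<rho>)" using \<beta>_le_1 rho by (intro mult_right_mono) auto
  also have "\<dots> < 1" using rho by simp
  finally show "0 < q" by (simp add: q_def)
  show "q < 1" using \<beta>_pos rho by (simp add: q_def)
qed

lemma hit_below_le_q: "good V y \<Longrightarrow> length y = Suc j \<Longrightarrow> hit j n V y \<le> q"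
  using hit_le_rho[OF escape, of V y j n] \<beta>_pos by (simp add: q_def algebra_simps)

text \<open>Level \<open>j\<close> is reached only through level \<open>Suc j\<close>, and on the
  first visit there the bound \<open>q\<close> holds whatever the past.\<close>

lemma hit_le_q_hit: "good V y \<Longrightarrow> j < length y \<Longrightarrow> hit j n V y \<le> q * hit (Suc j) n V y"
proof (induction n arbitrary: V y)
  case 0
  then show ?case using q by simp
next
  case (Suc n)
  show ?case
  proof (cases "length y = Suc j")
    case True
    then show ?thesis using hit_below_le_q[of V y j "Suc n"] Suc.prems by (simp add: surv_notin)
  next
    case False
    then have j: "Suc j < length y" using Suc.prems by simp
    have "avg (hit j n) V y \<le> avg (\<lambda>V y. q * hit (Suc j) n V y) V y"
    proof (rule avg_mono)
      fix V' y' assume "nxt V y V' y'"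
      then show "hit j n V' y' \<le> q * hit (Suc j) n V' y'"
        using Suc.IH[of V' y'] good_nxt Suc.prems(1) j by (fastforce simp: nxt_def)
    qed
    then show ?thesis using hit_Suc[OF j, of n V] hit_Suc[OF Suc.prems(2), of n V] by (simp only: avg_cmult)
  qed
qed

lemma hit_le_power: "good V y \<Longrightarrow> j \<le> length y \<Longrightarrow> hit j n V y \<le> q ^ (length y - j)"
proof (induction "length y - j" arbitrary: j)
  case (Suc d)
  then have "hit j n V y \<le> q * hit (Suc j) n V y" by (intro hit_le_q_hit) auto
  also have "\<dots> \<le> q * q ^ (length y - Suc j)" using Suc q by (intro mult_left_mono Suc.hyps) auto
  also have "\<dots> = q ^ (length y - j)" using Suc.hyps(2) by (metis Suc_diff_Suc diff_is_0_eq' nat.simps(3) nle_le power_Suc not_less)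
  finally show ?case .
qed simp

section \<open>A Lyapunov function\<close>

definition lam :: real where "lam = (1 + q) / 2"

lemma lam: "0 < lam" "lam < 1" "q < lam"
  using q by (auto simp: lam_def)

text \<open>
  The Lyapunov function of the chain. Since \<open>hit\<close> drops below one when a level is left upwards
  for ever, \<open>U\<close> loses a fixed proportion in each step; its time index is the remaining time.
\<close>

definition U :: "nat \<Rightarrow> nat list set \<Rightarrow> nat list \<Rightarrow> real" where
  "U n V y = (\<Sum>j<length y. lam ^ j * hit j n V y) + lam ^ length y / (1 - lam)"

text \<open>The first term bounds the geometric sum of \<open>lam ^ j * q ^ (h - j)\<close> over
  \<open>j < h\<close>, relative to \<open>lam ^ h\<close>; the second comes from the tail term of
  \<open>U\<close>.\<close>

definition C :: real where "C = q / (lam - q) + 1 / (1 - lam)"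

text \<open>A step to a child has probability at least \<open>b / (b + c)\<close>, and from the
  child the old level is never visited again with probability at least \<open>1 - q\<close>.\<close>

definition loss :: real where "loss = real b / (real b + c) * (1 - q)"

text \<open>One step lowers \<open>U\<close> by at least \<open>loss * lam ^ h\<close>, which is at
  least the fraction \<open>loss / C\<close> of \<open>U\<close> by \<open>U_le\<close>.\<close>

definition \<kappa> :: real where "\<kappa> = 1 - loss / C"

lemma C_ge_1: "1 < C"
proof -
  have "1 < 1 / (1 - lam)" "0 < q / (lam - q)" using lam q by (auto simp: field_simps)
  then show ?thesis by (simp add: C_def)
qed

lemma loss: "0 < loss" "loss < 1"
proof -
  have "0 < real b / (real b + c)" "real b / (real b + c) < 1" using b_ge_2 c_gt_1 by (auto simp: field_simps)
  moreover have "0 < 1 - q" "1 - q < 1" using q by auto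
  ultimately show "0 < loss" "loss < 1"
    using mult_strict_mono[of "real b / (real b + c)" 1 "1 - q" 1] mult_pos_pos[of "real b / (real b + c)" "1 - q"]
    unfolding loss_def by auto
qed

lemma \<kappa>: "0 < \<kappa>" "\<kappa> < 1"
  using C_ge_1 loss by (auto simp: \<kappa>_def field_simps)

lemma U_ge: "lam ^ length y \<le> U n V y"
proof -
  have "lam ^ length y \<le> lam ^ length y / (1 - lam)" using lam by (simp add: field_simps)
  moreover have "0 \<le> (\<Sum>j<length y. lam ^ j * hit j n V y)" using lam by (intro sum_nonneg) auto
  ultimately show ?thesis by (simp add: U_def)
qed

lemma U_nonneg [simp]: "0 \<le> U n V y"
  using U_ge[of y n V] lam zero_le_power[of lam "length y"] by linarith

lemma hit_le_U: "j < length y \<Longrightarrow> hit j n V y \<le> U n V y / lam ^ j"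
proof -
  assume j: "j < length y"
  have "lam ^ j * hit j n V y \<le> (\<Sum>j<length y. lam ^ j * hit j n V y)"
    using j lam by (intro member_le_sum) auto
  also have "\<dots> \<le> U n V y" using lam by (simp add: U_def)
  finally show ?thesis using lam by (simp add: field_simps)
qed

lemma U_le: "good V y \<Longrightarrow> U n V y \<le> C * lam ^ length y"
proof -
  assume g: "good V y"
  have "(\<Sum>j<h. lam ^ j * q ^ (h - j)) * (lam - q) = q * (lam ^ h - q ^ h)" for h
  proof (induction h)
    case (Suc h)
    have "(\<Sum>j<Suc h. lam ^ j * q ^ (Suc h - j)) = (\<Sum>j<h. q * (lam ^ j * q ^ (h - j))) + lam ^ h * q"
      by (simp add: Suc_diff_le mult_ac)
    also have "\<dots> = q * (\<Sum>j<h. lam ^ j * q ^ (h - j)) + lam ^ h * q"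
      by (simp only: sum_distrib_left)
    finally have "(\<Sum>j<Suc h. lam ^ j * q ^ (Suc h - j)) * (lam - q) =
        q * ((\<Sum>j<h. lam ^ j * q ^ (h - j)) * (lam - q)) + lam ^ h * q * (lam - q)"
      by (simp only: distrib_right mult.assoc)
    also have "\<dots> = q * (lam ^ Suc h - q ^ Suc h)" unfolding Suc by (simp add: algebra_simps)
    finally show ?case .
  qed simp
  then have "(\<Sum>j<length y. lam ^ j * q ^ (length y - j)) = q * (lam ^ length y - q ^ length y) / (lam - q)"
    using lam by (simp add: eq_divide_eq)
  then have "(\<Sum>j<length y. lam ^ j * q ^ (length y - j)) = lam ^ length y * (q / (lam - q)) - q ^ length y * (q / (lam - q))"
    by (simp add: right_diff_distrib diff_divide_distrib mult.commute)
  moreover have "0 \<le> q ^ length y * (q / (lam - q))" using q lam by simp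
  ultimately have "(\<Sum>j<length y. lam ^ j * q ^ (length y - j)) \<le> lam ^ length y * (q / (lam - q))" by simp
  moreover have "(\<Sum>j<length y. lam ^ j * hit j n V y) \<le> (\<Sum>j<length y. lam ^ j * q ^ (length y - j))"
    using g lam by (intro sum_mono mult_left_mono hit_le_power) auto
  ultimately show ?thesis by (simp add: U_def C_def algebra_simps)
qed

lemma avg_hit_level:
  assumes "good V y"
  shows "avg (hit (length y) n) V y \<le> 1 - loss"
proof -
  let ?S = "\<Sum>i<b. wt V (i # y)"
  let ?w = "if y = [] then 0 else c"
  have T: "total_wt V y = ?w + ?S" by (simp add: total_wt_def)
  have S: "real b \<le> ?S" by (rule sum_wt_ge)
  have "avg (hit (length y) n) V y * total_wt V y = (if y = [] then 0 else c * hit (length y) n V (tl y)) +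
     (\<Sum>i<b. wt V (i # y) * hit (length y) n (insert (i # y) V) (i # y))"
    unfolding avg_def using total_wt_pos[where V=V and y=y] by simp
  also have "\<dots> \<le> ?w + (\<Sum>i<b. wt V (i # y) * q)"
  proof (intro add_mono sum_mono mult_left_mono)
    show "(if y = [] then 0 else c * hit (length y) n V (tl y)) \<le> ?w"
      using c_gt_1 by (auto intro: mult_left_le)
    fix i assume "i \<in> {..<b}"
    then have "nxt V y (insert (i # y) V) (i # y)" by (auto simp: nxt_def)
    then have "good (insert (i # y) V) (i # y)" using good_nxt assms by blast
    then show "hit (length y) n (insert (i # y) V) (i # y) \<le> q" by (rule hit_below_le_q) simp
    show "0 \<le> wt V (i # y)" using wt_ge_1[where V=V and x="i # y"] by linarith
  qed
  also have "\<dots> = total_wt V y - (1 - q) * ?S" by (simp only: T sum_distrib_right[symmetric]) (simp add: algebra_simps)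
  \<comment> \<open>The child weights sum to at least \<open>b\<close> and the parent edge adds at
    most \<open>c\<close>, so the children carry at least the share
    \<open>b / (b + c)\<close>.\<close>
  also have "\<dots> \<le> total_wt V y - loss * total_wt V y"
  proof -
    have "real b * total_wt V y \<le> real b * (c + ?S)" unfolding T using c_gt_1 by (intro mult_left_mono) auto
    also have "\<dots> \<le> (real b + c) * ?S" using S c_gt_1 by (simp add: algebra_simps)
    finally have "real b / (real b + c) * total_wt V y \<le> ?S"
      using b_ge_2 c_gt_1 by (simp add: field_simps)
    then have "(1 - q) * (real b / (real b + c) * total_wt V y) \<le> (1 - q) * ?S"
      using q by (intro mult_left_mono) auto
    then show ?thesis by (simp add: loss_def mult_ac)
  qed
  finally have "avg (hit (length y) n) V y * total_wt V y \<le> (1 - loss) * total_wt V y"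
    by (simp add: algebra_simps)
  then show ?thesis using total_wt_pos[where V=V and y=y] by (simp only: mult_le_cancel_right)
qed

lemma avg_U_le:
  assumes "good V y"
  shows "avg (U n) V y \<le> \<kappa> * U (Suc n) V y"
proof -
  define h where "h = length y"
  \<comment> \<open>All neighbours are given the same range of levels: \<open>hit\<close> is 1 at
    and above the current height, and \<open>lam ^ h / (1 - lam)\<close> is the geometric tail of
    those levels.\<close>
  have "U n V' y' = (\<Sum>j<Suc h. lam ^ j * hit j n V' y') + lam ^ Suc h / (1 - lam)"
    if nx: "nxt V y V' y'" for V' y'
  proof -
    consider "length y' = Suc h" | g where "h = Suc g" "length y' = g"
      using nx by (cases y) (auto simp: nxt_def h_def)
    then show ?thesis
    proof cases
      case 1
      then show ?thesis by (simp only: U_def)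
    next
      case 2
      have "lam ^ g / (1 - lam) = lam ^ g + lam ^ Suc g + lam ^ Suc (Suc g) / (1 - lam)"
        using lam by (simp add: field_simps)
      then show ?thesis using 2 by (simp add: U_def surv_notin)
    qed
  qed
  then have "avg (U n) V y = avg (\<lambda>V y. (\<Sum>j<Suc h. lam ^ j * hit j n V y) + lam ^ Suc h / (1 - lam)) V y"
    by (rule avg_cong)
  also have "\<dots> = (\<Sum>j<h. lam ^ j * avg (hit j n) V y) + lam ^ h * avg (hit h n) V y + lam ^ Suc h / (1 - lam)"
    by (simp only: avg_add avg_sum avg_cmult avg_const sum.lessThan_Suc)
  also have "(\<Sum>j<h. lam ^ j * avg (hit j n) V y) = (\<Sum>j<h. lam ^ j * hit j (Suc n) V y)"
    by (intro sum.cong refl) (simp only: hit_Suc h_def lessThan_iff)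
  \<comment> \<open>Levels below \<open>h\<close> only shift their time index; the whole decrease
    comes from the current level \<open>h\<close>.\<close>
  also have "lam ^ h * avg (hit h n) V y \<le> lam ^ h * (1 - loss)"
    using avg_hit_level[OF assms] lam unfolding h_def by (intro mult_left_mono) auto
  also have "(\<Sum>j<h. lam ^ j * hit j (Suc n) V y) + lam ^ h * (1 - loss) + lam ^ Suc h / (1 - lam) =
      U (Suc n) V y - loss * lam ^ h"
    unfolding U_def h_def[symmetric] using lam by (simp add: field_simps del: surv.simps)
  also have "\<dots> \<le> \<kappa> * U (Suc n) V y"
    using mult_left_mono[OF U_le[OF assms, of "Suc n"], of loss] loss C_ge_1
    by (simp add: \<kappa>_def h_def field_simps)
  finally show ?thesis by simp
qed

abbreviation sv :: "nat \<Rightarrow> nat \<Rightarrow> nat list set \<Rightarrow> nat list \<Rightarrow> real" where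
  "sv M n \<equiv> surv {..<M} n"

lemma sv_Suc: "length y < M \<Longrightarrow> sv M (Suc n) V y = avg (sv M n) V y"
  by simp

text \<open>Below level \<open>M\<close> the function \<open>U\<close> is at least
  \<open>lam ^ M\<close>, while its mean shrinks by \<open>\<kappa>\<close> per step; this is
  Markov's inequality.\<close>

lemma sv_le_U: "good V y \<Longrightarrow> sv M n V y \<le> \<kappa> ^ n / lam ^ M * U n V y"
proof (induction n arbitrary: V y)
  case 0
  have "lam ^ M \<le> U 0 V y" if "length y < M"
    using U_ge[of y 0 V] power_decreasing[of "length y" M lam] lam that by linarith
  moreover have "0 \<le> U 0 V y / lam ^ M" using lam by simp
  ultimately show ?case using lam by (simp add: field_simps)
next
  case (Suc n)
  show ?case
  proof (cases "length y < M")
    case True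
    have "avg (sv M n) V y \<le> avg (\<lambda>V y. \<kappa> ^ n / lam ^ M * U n V y) V y"
      using Suc good_nxt by (intro avg_mono) blast
    also have "\<dots> = \<kappa> ^ n / lam ^ M * avg (U n) V y" by (rule avg_cmult)
    also have "\<dots> \<le> \<kappa> ^ n / lam ^ M * (\<kappa> * U (Suc n) V y)"
      using avg_U_le[OF Suc.prems] lam \<kappa> by (intro mult_left_mono) auto
    finally show ?thesis using True by (simp add: mult_ac)
  next
    case False
    then show ?thesis using lam \<kappa> by (simp add: surv_notin)
  qed
qed

text \<open>\<open>EM z M n\<close> is the expectation of \<open>z\<close> to the power of \<open>min n T\<close>, with \<open>T\<close> the hitting time of level \<open>M\<close>.\<close>

primrec EM :: "real \<Rightarrow> nat \<Rightarrow> nat \<Rightarrow> nat list set \<Rightarrow> nat list \<Rightarrow> real" where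
  "EM z M 0 = (\<lambda>V y. 1)"
| "EM z M (Suc n) = (\<lambda>V y. if length y < M then z * avg (EM z M n) V y else 1)"

text \<open>For \<open>z * \<kappa> \<le> 1\<close> the process \<open>z ^ n\<close> times
  \<open>U\<close> is a supermartingale, and up to level \<open>M\<close> it dominates
  \<open>lam ^ M * z ^ n\<close>.\<close>

lemma EM_le_U:
  assumes "0 \<le> z" "z * \<kappa> \<le> 1"
  shows "good V y \<Longrightarrow> length y \<le> M \<Longrightarrow> EM z M n V y \<le> U n V y / lam ^ M"
proof (induction n arbitrary: V y)
  case 0
  have "lam ^ M \<le> U 0 V y"
    using U_ge[of y 0 V] power_decreasing[of "length y" M lam] lam 0 by linarith
  then show ?case using lam by (simp add: field_simps)
next
  case (Suc n)
  show ?case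
  proof (cases "length y < M")
    case True
    have "avg (EM z M n) V y \<le> avg (\<lambda>V y. 1 / lam ^ M * U n V y) V y"
      using Suc True good_nxt by (intro avg_mono) (fastforce simp: nxt_def)
    also have "\<dots> = 1 / lam ^ M * avg (U n) V y" by (rule avg_cmult)
    also have "\<dots> \<le> 1 / lam ^ M * (\<kappa> * U (Suc n) V y)"
      using avg_U_le[OF Suc.prems(1)] lam by (intro mult_left_mono) auto
    finally have "z * avg (EM z M n) V y \<le> z * (1 / lam ^ M * (\<kappa> * U (Suc n) V y))"
      using assms by (intro mult_left_mono) auto
    also have "\<dots> = z * \<kappa> * (U (Suc n) V y / lam ^ M)" by simp
    also have "\<dots> \<le> 1 * (U (Suc n) V y / lam ^ M)" using assms lam by (intro mult_right_mono) auto
    finally show ?thesis using True by simp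
  next
    case False
    have "lam ^ M \<le> U (Suc n) V y"
      using U_ge[of y "Suc n" V] power_decreasing[of "length y" M lam] lam Suc.prems by linarith
    then show ?thesis using lam False by (simp add: field_simps)
  qed
qed

section \<open>Hitting times of levels\<close>

text \<open>The first visit to level \<open>m\<close> happens in a state satisfying \<open>newmax m\<close>, and before it the states satisfy \<open>below m\<close>.\<close>

definition below :: "nat \<Rightarrow> nat list set \<Rightarrow> nat list \<Rightarrow> bool" where
  "below l V y \<longleftrightarrow> good V y \<and> length y < l \<and> (\<forall>x\<in>V. length x < l)"

definition newmax :: "nat \<Rightarrow> nat list set \<Rightarrow> nat list \<Rightarrow> bool" where
  "newmax m V y \<longleftrightarrow> good V y \<and> length y = m \<and> (\<forall>x\<in>V. length x \<le> m \<and> (length x = m \<longrightarrow> x = y))"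

lemma below_start: "0 < l \<Longrightarrow> below l {} []"
  by (simp add: below_def good_start)

lemma below_nxt: "below l V y \<Longrightarrow> nxt V y V' y' \<Longrightarrow> below l V' y' \<or> newmax l V' y'"
  using good_nxt[of V y V' y'] by (fastforce simp: below_def newmax_def nxt_def)

lemma below_nxt_Suc: "below l V y \<Longrightarrow> nxt V y V' y' \<Longrightarrow> below (Suc l) V' y'"
  using good_nxt[of V y V' y'] by (fastforce simp: below_def nxt_def)

lemma below_mono: "below l V y \<Longrightarrow> l \<le> l' \<Longrightarrow> below l' V y"
  by (fastforce simp: below_def)

lemma newmax_below: "newmax m V y \<Longrightarrow> below (Suc m) V y"
  by (auto simp: below_def newmax_def)

text \<open>If \<open>M\<close> is not reached by time \<open>u + v\<close>, then either level
  \<open>l\<close> is not reached by time \<open>u\<close>, or more than \<open>v\<close> steps pass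
  after its first visit.\<close>

lemma sv_split_at_level:
  assumes G: "\<And>V y. newmax l V y \<Longrightarrow> sv M v V y \<le> G" and "0 \<le> G" and "l \<le> M"
  shows "below l V y \<Longrightarrow> sv M (u + v) V y \<le> sv l u V y + G"
proof (induction u arbitrary: V y)
  case 0
  have "sv l 0 V y = 1" using 0 by (simp add: below_def)
  then show ?case using surv_le_1[of "{..<M}" v V y] \<open>0 \<le> G\<close> unfolding add_0 by linarith
next
  case (Suc u)
  have l: "length y < l" "length y < M" using Suc.prems \<open>l \<le> M\<close> by (auto simp: below_def)
  have "avg (sv M (u + v)) V y \<le> avg (\<lambda>V y. sv l u V y + G) V y"
  proof (rule avg_mono)
    fix V' y' assume "nxt V y V' y'"
    then consider "below l V' y'" | "newmax l V' y'" using below_nxt Suc.prems by blast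
    then show "sv M (u + v) V' y' \<le> sv l u V' y' + G"
    proof cases
      case 2
      have "sv M (u + v) V' y' \<le> sv M v V' y'" by (rule surv_antimono) simp
      then show ?thesis using G[OF 2] by (smt (verit) surv_nonneg)
    qed (rule Suc.IH)
  qed
  then show ?case using l by (simp add: avg_add)
qed

lemma sv_le_hit: "sv M n V y \<le> surv {j<..<M} n V y + hit j n V y"
proof (induction n arbitrary: V y)
  case (Suc n)
  show ?case
  proof (cases "j < length y \<and> length y < M")
    case True
    have "avg (sv M n) V y \<le> avg (\<lambda>V y. surv {j<..<M} n V y + hit j n V y) V y"
      by (rule avg_mono) (rule Suc)
    then show ?thesis using True hit_Suc[of j y n V] by (simp add: avg_add del: surv.simps(2)) (simp add: avg_diff)
  next
    case False
    then show ?thesis by (cases "j < length y") (simp_all add: surv_notin hit_low del: surv.simps)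
  qed
qed auto

text \<open>
  The walk either reaches level \<open>M\<close> without visiting level \<open>j\<close>, or visits level \<open>j\<close> only after
  time \<open>a\<close>, or is slow to reach level \<open>l\<close>; otherwise it visits level \<open>j\<close> before time \<open>a\<close>, hence
  before level \<open>l\<close>, and starts afresh when it first reaches level \<open>l\<close>.
\<close>

lemma sv_attempt:
  assumes G: "\<And>V y. newmax l V y \<Longrightarrow> sv M v V y \<le> G" and "0 \<le> G" and "l \<le> M"
  shows "below l0 V y \<Longrightarrow> l0 + a \<le> l \<Longrightarrow> j < length y \<Longrightarrow>
    sv M (a + k + v) V y \<le> surv {j<..<M} (a + k + v) V y
      + (\<kappa> ^ a / lam ^ j * U (a + k + v) V y + (sv l (a + k) V y + G * hit j a V y))"
proof (induction a arbitrary: l0 V y)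
  case 0
  \<comment> \<open>The window for an early visit to \<open>j\<close> has closed, so any further
    visit is charged to the \<open>U\<close> term.\<close>
  have "0 \<le> G * hit j 0 V y" using \<open>0 \<le> G\<close> by (intro mult_nonneg_nonneg) auto
  moreover have "\<kappa> ^ 0 / lam ^ j * U (0 + k + v) V y = U (0 + k + v) V y / lam ^ j" by simp
  ultimately show ?case using sv_le_hit[of M "0 + k + v" V y j] hit_le_U[OF 0(3), of "0 + k + v" V]
      surv_nonneg[of "{..<l}" "0 + k" V y] by linarith
next
  case (Suc a)
  let ?t = "a + k + v"
  have g: "good V y" and h: "length y < l0" "length y < l" "length y < M" "j < length y"
    using Suc.prems \<open>l \<le> M\<close> by (auto simp: below_def)
  have "sv M (Suc a + k + v) V y = avg (sv M ?t) V y" using h by simp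
  also have "\<dots> \<le> avg (\<lambda>V y. surv {j<..<M} ?t V y
      + (\<kappa> ^ a / lam ^ j * U ?t V y + (sv l (a + k) V y + G * hit j a V y))) V y"
  proof (rule avg_mono)
    fix V' y' assume nx: "nxt V y V' y'"
    then have bl: "below (Suc l0) V' y'" using below_nxt_Suc Suc.prems(1) by blast
    have "j < length y' \<or> length y' = j" using nx h by (auto simp: nxt_def)
    then show "sv M ?t V' y' \<le> surv {j<..<M} ?t V' y'
      + (\<kappa> ^ a / lam ^ j * U ?t V' y' + (sv l (a + k) V' y' + G * hit j a V' y'))"
    proof
      assume "j < length y'"
      then show ?thesis using Suc.IH[OF bl] Suc.prems by simp
    next
      assume aj: "length y' = j"
      \<comment> \<open>Each step raises the largest visited height by at most one, and
        \<open>l0 + a \<le> l\<close>; so level \<open>l\<close> is still unvisited.\<close>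
      have "below l V' y'" using bl Suc.prems(2) by (auto elim: below_mono)
      then have "sv M ?t V' y' \<le> sv l (a + k) V' y' + G"
        using sv_split_at_level[OF G \<open>0 \<le> G\<close> \<open>l \<le> M\<close>] by simp
      moreover have "G * hit j a V' y' = G" using aj by (simp add: hit_low)
      moreover have "0 \<le> \<kappa> ^ a / lam ^ j * U ?t V' y'" using \<kappa> lam by simp
      ultimately show ?thesis using surv_nonneg[of "{j<..<M}" ?t V' y'] by linarith
    qed
  qed
  also have "\<dots> = avg (surv {j<..<M} ?t) V y + (\<kappa> ^ a / lam ^ j * avg (U ?t) V y
      + (avg (sv l (a + k)) V y + G * avg (hit j a) V y))"
    by (simp only: avg_add avg_cmult)
  also have "\<dots> \<le> surv {j<..<M} (Suc ?t) V y + (\<kappa> ^ a / lam ^ j * (\<kappa> * U (Suc ?t) V y)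
      + (sv l (Suc (a + k)) V y + G * hit j (Suc a) V y))"
  proof (intro add_mono mult_left_mono)
    show "avg (U ?t) V y \<le> \<kappa> * U (Suc ?t) V y" by (rule avg_U_le[OF g])
    show "0 \<le> \<kappa> ^ a / lam ^ j" using \<kappa> lam by simp
    show "avg (hit j a) V y \<le> hit j (Suc a) V y" using hit_Suc[OF h(4)] by (simp del: surv.simps)
  qed (use h \<open>0 \<le> G\<close> in auto)
  finally show ?case by (simp add: mult_ac)
qed

definition newmax_bound :: "nat \<Rightarrow> nat \<Rightarrow> real \<Rightarrow> bool" where
  "newmax_bound L t \<gamma> \<longleftrightarrow> (\<forall>m V y. 1 \<le> m \<longrightarrow> newmax m V y \<longrightarrow> sv (m + L) t V y \<le> \<gamma>)"

text \<open>One attempt: \<open>\<nu>\<close> covers walks that stay in the subtree,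
  \<open>e\<close> late returns to the parent and slow arrival at level \<open>m + Suc a\<close>. An
  early return has probability at most \<open>1 - \<beta>\<close> and leads to a new attempt there,
  with \<open>L - Suc a\<close> levels to go.\<close>

lemma newmax_bound_step:
  assumes rb: "newmax_bound (L - Suc a) v \<gamma>" and "0 \<le> \<gamma>" and L: "Suc a \<le> L"
    and \<nu>: "surv {0<..<Suc L} (a + k + v) {[0]} [0] \<le> \<nu>"
    and e: "C * \<kappa> ^ a + C * \<kappa> ^ (a + k) / lam ^ Suc a \<le> e"
  shows "newmax_bound L (a + k + v) (\<nu> + e + (1 - \<beta>) * \<gamma>)"
  unfolding newmax_bound_def
proof (intro allI impI)
  fix m V y assume m: "1 \<le> m" and rec: "newmax m V y"
  \<comment> \<open>Level \<open>m + Suc a\<close> is out of reach within \<open>a\<close> steps, so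
    after an early return it is still to be visited for the first time.\<close>
  let ?M = "m + L" and ?l = "m + Suc a" and ?t = "a + k + v"
  have g: "good V y" and ly: "length y = m" using rec by (auto simp: newmax_def)
  have y_ne: "y \<noteq> []" using m ly by auto
  have "sv ?M v V' y' \<le> \<gamma>" if "newmax ?l V' y'" for V' y'
  proof -
    have "1 \<le> ?l" "?M = ?l + (L - Suc a)" using L by auto
    then show ?thesis using rb that unfolding newmax_bound_def by metis
  qed
  note G = this
  have "sv ?M ?t V y \<le> surv {m - 1<..<?M} ?t V y
      + (\<kappa> ^ a / lam ^ (m - 1) * U ?t V y + (sv ?l (a + k) V y + \<gamma> * hit (m - 1) a V y))"
    by (rule sv_attempt[OF G \<open>0 \<le> \<gamma>\<close> _ newmax_below[OF rec]]) (use L m ly in auto)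
  also have "\<dots> \<le> \<nu> + (C * \<kappa> ^ a + (C * \<kappa> ^ (a + k) / lam ^ Suc a + \<gamma> * (1 - \<beta>)))"
  proof (intro add_mono mult_left_mono \<open>0 \<le> \<gamma>\<close>)
    have fresh: "z @ y \<notin> V" if "z \<noteq> []" for z
    proof
      assume "z @ y \<in> V"
      then have "length (z @ y) \<le> m" using rec by (auto simp: newmax_def)
      then show False using that ly by simp
    qed
    have "y \<in> V" using g y_ne by (simp add: good_def)
    note fr = fresh_surv[OF y_ne this fresh, simplified ly]
    show "surv {m - 1<..<?M} ?t V y \<le> \<nu>" using fr(2)[of L ?t] \<nu> by simp
    show "hit (m - 1) a V y \<le> 1 - \<beta>" using fr(1)[of a] escape[of a] by simp
    have U: "U n V y \<le> C * lam ^ m" for n using U_le[OF g] ly by simp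
    have lam_m: "lam ^ m = lam * lam ^ (m - 1)" using m by (cases m) auto
    have "\<kappa> ^ a / lam ^ (m - 1) * U ?t V y \<le> \<kappa> ^ a / lam ^ (m - 1) * (C * lam ^ m)"
      using U \<kappa> lam by (intro mult_left_mono) auto
    also have "\<dots> = lam * (C * \<kappa> ^ a)" using lam by (simp add: lam_m)
    also have "\<dots> \<le> 1 * (C * \<kappa> ^ a)" using lam \<kappa> C_ge_1 by (intro mult_right_mono) auto
    finally show "\<kappa> ^ a / lam ^ (m - 1) * U ?t V y \<le> C * \<kappa> ^ a" by simp
    have "sv ?l (a + k) V y \<le> \<kappa> ^ (a + k) / lam ^ ?l * U (a + k) V y" by (rule sv_le_U[OF g])
    also have "\<dots> \<le> \<kappa> ^ (a + k) / lam ^ ?l * (C * lam ^ m)"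
      using U \<kappa> lam by (intro mult_left_mono) auto
    also have "\<dots> = C * \<kappa> ^ (a + k) / lam ^ Suc a" using lam by (simp add: power_add)
    finally show "sv ?l (a + k) V y \<le> C * \<kappa> ^ (a + k) / lam ^ Suc a" .
  qed
  finally show "sv ?M ?t V y \<le> \<nu> + e + (1 - \<beta>) * \<gamma>" using e by (simp add: mult.commute)
qed

text \<open>The recursion \<open>\<gamma> \<mapsto> \<nu> + e + (1 - \<beta>) * \<gamma>\<close> has
  fixed point \<open>(\<nu> + e) / \<beta>\<close>, and the distance to it contracts by
  \<open>1 - \<beta>\<close> in each of the \<open>r\<close> rounds.\<close>

lemma newmax_bound_iterate:
  assumes e: "C * \<kappa> ^ a + C * \<kappa> ^ (a + k) / lam ^ Suc a \<le> e" and "0 \<le> e"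
  shows "r * Suc a \<le> L \<Longrightarrow> surv {0<..<Suc L} t {[0]} [0] \<le> \<nu> \<Longrightarrow>
    newmax_bound L (t + r * (a + k)) ((\<nu> + e) / \<beta> + (1 - \<beta>) ^ r)"
proof (induction r arbitrary: L)
  case 0
  have "0 \<le> \<nu>" using 0(2) surv_nonneg[of "{0<..<Suc L}" t "{[0]}" "[0]"] by linarith
  then have "0 \<le> (\<nu> + e) / \<beta>" using \<open>0 \<le> e\<close> \<beta>_pos by simp
  then have "sv M t' V y \<le> (\<nu> + e) / \<beta> + (1 - \<beta>) ^ 0" for M t' V y
    using surv_le_1[of "{..<M}" t' V y] unfolding power_0 by linarith
  then show ?case unfolding newmax_bound_def by blast
next
  case (Suc r)
  let ?\<gamma> = "(\<nu> + e) / \<beta> + (1 - \<beta>) ^ r"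
  \<comment> \<open>A shorter climb is not slower, so \<open>\<nu>\<close> also serves the remaining
    levels.\<close>
  have "surv {0<..<Suc (L - Suc a)} t {[0]} [0] \<le> surv {0<..<Suc L} t {[0]} [0]"
    by (rule surv_mono_set) auto
  then have "newmax_bound (L - Suc a) (t + r * (a + k)) ?\<gamma>"
    using Suc.prems by (intro Suc.IH) auto
  moreover have "0 \<le> \<nu>" using Suc.prems(2) surv_nonneg[of "{0<..<Suc L}" t "{[0]}" "[0]"] by linarith
  then have "0 \<le> ?\<gamma>" using \<open>0 \<le> e\<close> \<beta>_pos \<beta>_le_1 by (intro add_nonneg_nonneg divide_nonneg_nonneg zero_le_power) auto
  moreover have "surv {0<..<Suc L} (a + k + (t + r * (a + k))) {[0]} [0] \<le> \<nu>"
    using Suc.prems(2) surv_antimono[of t "a + k + (t + r * (a + k))" "{0<..<Suc L}" "{[0]}" "[0]"] by linarith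
  ultimately have "newmax_bound L (a + k + (t + r * (a + k))) (\<nu> + e + (1 - \<beta>) * ?\<gamma>)"
    using Suc.prems(1) e by (intro newmax_bound_step) auto
  moreover have "\<nu> + e + (1 - \<beta>) * ?\<gamma> = (\<nu> + e) / \<beta> + (1 - \<beta>) ^ Suc r"
  proof -
    have "\<nu> + e = \<beta> * ((\<nu> + e) / \<beta>)" using \<beta>_pos by simp
    moreover have "\<beta> * x + (1 - \<beta>) * (x + (1 - \<beta>) ^ r) = x + (1 - \<beta>) ^ Suc r" for x
      by (simp add: algebra_simps)
    ultimately show ?thesis by metis
  qed
  moreover have "a + k + (t + r * (a + k)) = t + Suc r * (a + k)" by simp
  ultimately show ?case by (simp only:)
qed

section \<open>Exponential moments of hitting times\<close>

lemma EM_top: "M \<le> length y \<Longrightarrow> EM z M n V y = 1"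
  by (cases n) auto

lemma EM_nonneg: "0 \<le> z \<Longrightarrow> 0 \<le> EM z M n V y"
proof (induction n arbitrary: V y)
  case (Suc n)
  have "avg (\<lambda>_ _. 0) V y \<le> avg (EM z M n) V y" using Suc by (intro avg_mono) auto
  then show ?case using Suc.prems by simp
qed simp

lemma EM_mono:
  assumes "0 \<le> z" "z \<le> w"
  shows "EM z M n V y \<le> EM w M n V y"
proof (induction n arbitrary: V y)
  case (Suc n)
  have "avg (EM z M n) V y \<le> avg (EM w M n) V y" by (rule avg_mono) (rule Suc)
  moreover have "avg (\<lambda>_ _. 0) V y \<le> avg (EM z M n) V y" using EM_nonneg assms(1) by (intro avg_mono) auto
  ultimately show ?case using assms by (auto intro: mult_mono)
qed simp

lemma sv_le_EM: "0 \<le> z \<Longrightarrow> z ^ n * sv M n V y \<le> EM z M n V y"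
proof (induction n arbitrary: V y)
  case (Suc n)
  have "avg (\<lambda>V y. z ^ n * sv M n V y) V y \<le> avg (EM z M n) V y" using Suc by (intro avg_mono) auto
  then have "z * (z ^ n * avg (sv M n) V y) \<le> z * avg (EM z M n) V y"
    using Suc.prems unfolding avg_cmult by (intro mult_left_mono) auto
  then show ?case by (simp add: mult_ac)
qed simp

text \<open>The strong Markov property at the first visit to level \<open>l\<close>: a bound uniform
  over all states there factors out, so bounds for successive blocks multiply.\<close>

lemma EM_split_at_level:
  assumes K: "\<And>V y n. newmax l V y \<Longrightarrow> EM z M n V y \<le> K" and "1 \<le> K" "0 \<le> z" "l \<le> M"
  shows "below l V y \<Longrightarrow> EM z M n V y \<le> K * EM z l n V y"
proof (induction n arbitrary: V y)
  case 0
  then show ?case using \<open>1 \<le> K\<close> by simp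
next
  case (Suc n)
  have l: "length y < l" "length y < M" using Suc.prems \<open>l \<le> M\<close> by (auto simp: below_def)
  have "avg (EM z M n) V y \<le> avg (\<lambda>V y. K * EM z l n V y) V y"
  proof (rule avg_mono)
    fix V' y' assume "nxt V y V' y'"
    then consider "below l V' y'" | "newmax l V' y'" using below_nxt Suc.prems by blast
    then show "EM z M n V' y' \<le> K * EM z l n V' y'"
    proof cases
      case 2
      then have "EM z l n V' y' = 1" by (intro EM_top) (simp add: newmax_def)
      then show ?thesis using K[OF 2] by simp
    qed (rule Suc.IH)
  qed
  then have "z * avg (EM z M n) V y \<le> z * (K * avg (EM z l n) V y)"
    using \<open>0 \<le> z\<close> unfolding avg_cmult by (intro mult_left_mono) auto
  then show ?case using l by (simp add: mult_ac)
qed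

text \<open>
  The two truncation lemmas integrate the pointwise bound
  \<open>z ^ T \<le> z ^ t + z ^ u * [T > t] + (z / w) ^ u * w ^ T\<close>, whose three terms
  cover \<open>T \<le> t\<close>, \<open>t < T \<le> u\<close> and \<open>u < T\<close>.
\<close>

lemma EM_truncate_once:
  assumes "1 \<le> z" "z \<le> w"
  shows "EM z M n V y \<le> z ^ u + (z / w) ^ u * EM w M n V y"
proof (induction n arbitrary: V y u)
  case 0
  have "1 \<le> z ^ u" "0 \<le> (z / w) ^ u" using assms by auto
  then show ?case by simp
next
  case (Suc n)
  have w: "0 < w" "0 \<le> w" using assms by auto
  show ?case
  proof (cases u)
    case 0
    then show ?thesis using EM_mono[of z w M "Suc n" V y] assms by (simp del: EM.simps)
  next
    case (Suc u')
    show ?thesis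
    proof (cases "length y < M")
      case True
      have "z * avg (EM z M n) V y \<le> z * avg (\<lambda>V y. z ^ u' + (z / w) ^ u' * EM w M n V y) V y"
        using Suc.IH assms by (intro mult_left_mono avg_mono) auto
      also have "\<dots> = z ^ u + (z / w) ^ u' * (z / w * w) * avg (EM w M n) V y"
        using w by (simp add: avg_add avg_cmult Suc algebra_simps)
      finally show ?thesis using True w unfolding Suc by (simp add: mult_ac)
    next
      case False
      have "1 \<le> z ^ u" "0 \<le> (z / w) ^ u" using assms by auto
      then show ?thesis using False by simp
    qed
  qed
qed

lemma EM_truncate:
  assumes "1 \<le> z" "z \<le> w"
  shows "EM z M n V y \<le> z ^ t + (z ^ u * sv M t V y + (z / w) ^ u * EM w M n V y)"
proof (induction n arbitrary: V y t u)
  case 0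
  have "1 \<le> z ^ t" "0 \<le> (z / w) ^ u" "0 \<le> z ^ u * sv M t V y" using assms by auto
  then show ?case by (simp del: surv.simps)
next
  case (Suc n)
  have w: "0 < w" "0 \<le> w" using assms by auto
  have pos: "1 \<le> z ^ t" "0 \<le> (z / w) ^ u" "0 \<le> z ^ u * sv M t V y" "1 \<le> z ^ u" using assms by auto
  show ?case
  proof (cases "length y < M")
    case False
    then have "EM z M (Suc n) V y = 1" by simp
    also have "1 \<le> z ^ t + (z ^ u * sv M t V y + (z / w) ^ u * EM w M (Suc n) V y)"
      using pos w EM_nonneg[of w M "Suc n" V y]
      by (intro add_increasing2 add_nonneg_nonneg mult_nonneg_nonneg) (auto simp del: surv.simps EM.simps)
    finally show ?thesis .
  next
    case True
    \<comment> \<open>The clocks \<open>t\<close> and \<open>u\<close> run down together. At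
      \<open>t = 0\<close> the two-term bound suffices, at \<open>u = 0\<close> the last term
      alone.\<close>
    consider "t = 0" | "u = 0" | t' u' where "t = Suc t'" "u = Suc u'" by (cases t; cases u) auto
    then show ?thesis
    proof cases
      case 1
      then have "sv M t V y = 1" using True by simp
      then show ?thesis using EM_truncate_once[OF assms, of M "Suc n" V y u] pos by (simp del: surv.simps EM.simps)
    next
      case 2
      have "EM z M (Suc n) V y \<le> EM w M (Suc n) V y" using assms by (intro EM_mono) auto
      also have "\<dots> = (z / w) ^ u * EM w M (Suc n) V y" using 2 by simp
      also have "\<dots> \<le> z ^ t + (z ^ u * sv M t V y + (z / w) ^ u * EM w M (Suc n) V y)"
        using pos by (intro add_increasing order_refl) auto
      finally show ?thesis .
    next
      case 3
      have "z * avg (EM z M n) V y \<le>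
          z * avg (\<lambda>V y. z ^ t' + (z ^ u' * sv M t' V y + (z / w) ^ u' * EM w M n V y)) V y"
        using Suc.IH assms by (intro mult_left_mono avg_mono) auto
      also have "\<dots> = z ^ t + (z ^ u * avg (sv M t') V y + (z / w) ^ u' * (z / w * w) * avg (EM w M n) V y)"
        using w by (simp only: avg_add avg_cmult avg_const 3) (simp add: algebra_simps)
      finally show ?thesis using True w unfolding 3 by (simp add: mult_ac)
    qed
  qed
qed

section \<open>Low heights at a fixed time\<close>

lemma mass_le_1: "mass A n V y \<le> 1"
proof (induction n arbitrary: V y)
  case (Suc n)
  have "avg (mass A n) V y \<le> avg (\<lambda>_ _. 1) V y" by (rule avg_mono) (rule Suc)
  then show ?case by simp
qed simp

lemma mass_mono: "A \<subseteq> B \<Longrightarrow> mass A n V y \<le> mass B n V y"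
  by (induction n arbitrary: V y) (auto intro!: avg_mono)

lemma mass_le_hit: "mass {..j} n V y \<le> hit j n V y"
proof (induction n arbitrary: V y)
  case (Suc n)
  show ?case
  proof (cases "j < length y")
    case True
    have "avg (mass {..j} n) V y \<le> avg (hit j n) V y" by (rule avg_mono) (rule Suc)
    then show ?thesis unfolding hit_Suc[OF True] by simp
  next
    case False
    then show ?thesis using mass_le_1[of "{..j}" "Suc n" V y] by (simp add: hit_low del: surv.simps mass.simps)
  qed
qed auto

text \<open>To be at height at most \<open>j\<close>, the walk has either not reached
  \<open>M\<close> yet or has since descended \<open>M - j\<close> levels.\<close>

lemma mass_le_sv:
  assumes "j \<le> M"
  shows "good V y \<Longrightarrow> length y \<le> M \<Longrightarrow> mass {..j} n V y \<le> sv M n V y + q ^ (M - j)"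
proof (induction n arbitrary: V y)
  case 0
  have "0 < q ^ (M - j)" using q by simp
  then show ?case using 0 assms by auto
next
  case (Suc n)
  show ?case
  proof (cases "length y = M")
    case True
    have "mass {..j} (Suc n) V y \<le> hit j (Suc n) V y" by (rule mass_le_hit)
    also have "\<dots> \<le> q ^ (length y - j)" using assms True Suc.prems by (intro hit_le_power) auto
    finally show ?thesis using True surv_nonneg[of "{..<M}" "Suc n" V y] by simp
  next
    case False
    then have "length y < M" using Suc.prems by simp
    moreover have "avg (mass {..j} n) V y \<le> avg (\<lambda>V y. sv M n V y + q ^ (M - j)) V y"
    proof (rule avg_mono)
      fix V' y' assume "nxt V y V' y'"
      then show "mass {..j} n V' y' \<le> sv M n V' y' + q ^ (M - j)"
        using Suc.IH[of V' y'] good_nxt[of V y V' y'] Suc.prems(1) \<open>length y < M\<close> by (auto simp: nxt_def)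
    qed
    ultimately show ?thesis by (simp add: avg_add)
  qed
qed

lemma newmax_bound_mono:
  assumes "newmax_bound L t \<gamma>" "t \<le> t'" "\<gamma> \<le> \<gamma>'"
  shows "newmax_bound L t' \<gamma>'"
  unfolding newmax_bound_def
proof (intro allI impI)
  fix m V y assume "1 \<le> m" "newmax m V y"
  then have "sv (m + L) t V y \<le> \<gamma>" using assms(1) by (auto simp: newmax_bound_def)
  then show "sv (m + L) t' V y \<le> \<gamma>'"
    using surv_antimono[OF assms(2), of "{..<m + L}" V y] assms(3) by linarith
qed

section \<open>From the speed to exponential decay\<close>

context
  fixes S :: real
  assumes S_pos: "0 < S"
    and speed: "\<And>\<delta>. 0 < \<delta> \<Longrightarrow> (\<lambda>n. mass {h. real h < (S - \<delta>) * real n} n {} []) \<longlonglongrightarrow> 0"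
begin

text \<open>Not having reached level \<open>Suc L\<close> by time about \<open>L * \<tau>\<close>
  means a height below \<open>1 / \<tau>\<close> times the time, and \<open>1 / \<tau> < S\<close>.
  The first step from the root leads to \<open>[0]\<close> with probability at least
  \<open>1 / (c * (b + 1))\<close>, which transfers the estimate.\<close>

lemma surv_above_root_tendsto_0:
  assumes "1 / S < \<tau>"
  shows "(\<lambda>L. surv {0<..<Suc L} (nat \<lfloor>real L * \<tau>\<rfloor>) {[0]} [0]) \<longlonglongrightarrow> 0"
proof -
  have \<tau>: "0 < \<tau>" using assms S_pos less_trans[of 0 "1 / S" \<tau>] by simp
  define \<delta> where "\<delta> = S - 1 / \<tau>"
  have \<delta>: "0 < \<delta>" using assms S_pos \<tau> by (simp add: \<delta>_def field_simps)
  let ?t = "\<lambda>L. nat \<lfloor>real L * \<tau>\<rfloor>" and ?K = "c * (real b + 1)"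
  have K: "0 < ?K" using c_gt_1 by (intro mult_pos_pos) auto
  have "filterlim (\<lambda>L. real L * \<tau>) at_top sequentially"
    using \<tau> by (intro filterlim_at_top_mult_tendsto_pos[OF tendsto_const] filterlim_real_sequentially)
  then have "filterlim (\<lambda>L. \<lfloor>real L * \<tau>\<rfloor>) at_top sequentially"
    by (rule filterlim_compose[OF filterlim_floor_sequentially])
  then have "filterlim ?t sequentially sequentially"
    by (rule filterlim_compose[OF filterlim_nat_sequentially])
  then have "filterlim (\<lambda>L. Suc (?t L)) sequentially sequentially"
    by (rule filterlim_compose[OF filterlim_Suc])
  from filterlim_compose[OF speed[OF \<delta>] this]
  have lim: "(\<lambda>L. ?K * mass {h. real h < (S - \<delta>) * real (Suc (?t L))} (Suc (?t L)) {} []) \<longlonglongrightarrow> ?K * 0"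
    by (rule tendsto_mult_left)
  have "surv {0<..<Suc L} (?t L) {[0]} [0]
      \<le> ?K * mass {h. real h < (S - \<delta>) * real (Suc (?t L))} (Suc (?t L)) {} []" for L
  proof -
    have "surv {0<..<Suc L} (?t L) {[0]} [0] \<le> sv (Suc L) (?t L) {[0]} [0]"
      by (rule surv_mono_set) auto
    also have "\<dots> \<le> ?K * avg (sv (Suc L) (?t L)) {} []"
      using avg_ge_child[of "sv (Suc L) (?t L)" 0 "[]" "{}"] b_ge_2 K by (simp add: divide_le_eq mult.commute)
    also have "\<dots> \<le> ?K * mass {h. real h < (S - \<delta>) * real (Suc (?t L))} (Suc (?t L)) {} []"
    proof (rule mult_left_mono)
      have "avg (sv (Suc L) (?t L)) {} [] \<le> mass {..<Suc L} (Suc (?t L)) {} []"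
        using surv_le_mass[of "{..<Suc L}" "Suc (?t L)" "{}" "[]"] sv_Suc[of "[]" "Suc L"] by (simp del: surv.simps)
      also have "\<dots> \<le> mass {h. real h < (S - \<delta>) * real (Suc (?t L))} (Suc (?t L)) {} []"
      proof (rule mass_mono, safe)
        fix h assume "h < Suc L"
        then have "real h * \<tau> \<le> real L * \<tau>" using \<tau> by (intro mult_right_mono) auto
        also have "\<dots> < real (Suc (?t L))" using \<tau> by simp linarith
        finally show "real h < (S - \<delta>) * real (Suc (?t L))" using \<tau> by (simp add: \<delta>_def field_simps)
      qed
      finally show "avg (sv (Suc L) (?t L)) {} [] \<le> \<dots>" .
    qed (use K in simp)
    finally show ?thesis .
  qed
  moreover have "(\<lambda>L. ?K * mass {h. real h < (S - \<delta>) * real (Suc (?t L))} (Suc (?t L)) {} []) \<longlonglongrightarrow> 0"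
    using lim by simp
  ultimately show ?thesis
    by (rule tendsto_0_sandwich) (rule surv_nonneg)
qed

lemma newmax_bound_eventually:
  assumes \<tau>: "1 / S < \<tau>" and \<eta>: "0 < \<eta>"
  shows "eventually (\<lambda>L. newmax_bound L (nat \<lfloor>real L * \<tau>\<rfloor>) \<eta>) sequentially"
proof -
  \<comment> \<open>The slack between \<open>\<tau>1\<close> and \<open>\<tau>\<close> will absorb
    the extra time \<open>r * (a + k)\<close> of failed attempts. The constants are fixed in the
    order \<open>r\<close>, \<open>e\<close>, \<open>a\<close>, \<open>k\<close>, and
    \<open>L\<close> is large last.\<close>
  obtain \<tau>1 where \<tau>1: "1 / S < \<tau>1" "\<tau>1 < \<tau>" using \<tau> dense by blast
  have "(\<lambda>r. (1 - \<beta>) ^ r) \<longlonglongrightarrow> 0" using \<beta>_pos \<beta>_le_1 by (intro LIMSEQ_power_zero) auto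
  then have "eventually (\<lambda>r. (1 - \<beta>) ^ r < \<eta> / 2) sequentially" using \<eta> by (intro order_tendstoD) auto
  then obtain r where r: "(1 - \<beta>) ^ r < \<eta> / 2" by (auto simp: eventually_sequentially)
  \<comment> \<open>With both errors at most \<open>e\<close>, the fixed point
    \<open>(e + e) / \<beta>\<close> is \<open>\<eta> / 2\<close>.\<close>
  define e where "e = \<beta> * \<eta> / 4"
  have e: "0 < e" using \<beta>_pos \<eta> by (simp add: e_def)
  have \<kappa>0: "(\<lambda>n. \<kappa> ^ n) \<longlonglongrightarrow> 0" using \<kappa> by (intro LIMSEQ_power_zero) auto
  have "(\<lambda>a. C * \<kappa> ^ a) \<longlonglongrightarrow> C * 0" by (intro tendsto_mult_left \<kappa>0)
  then have "eventually (\<lambda>a. C * \<kappa> ^ a < e / 2) sequentially" using e by (intro order_tendstoD) auto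
  then obtain a where a: "C * \<kappa> ^ a < e / 2" by (auto simp: eventually_sequentially)
  have "(\<lambda>k. C * \<kappa> ^ a / lam ^ Suc a * \<kappa> ^ k) \<longlonglongrightarrow> C * \<kappa> ^ a / lam ^ Suc a * 0" by (intro tendsto_mult_left \<kappa>0)
  then have "eventually (\<lambda>k. C * \<kappa> ^ a / lam ^ Suc a * \<kappa> ^ k < e / 2) sequentially" using e by (intro order_tendstoD) auto
  then obtain k where k: "C * \<kappa> ^ a / lam ^ Suc a * \<kappa> ^ k < e / 2" by (auto simp: eventually_sequentially)
  have ak: "C * \<kappa> ^ a + C * \<kappa> ^ (a + k) / lam ^ Suc a \<le> e"
  proof -
    have "C * \<kappa> ^ a / lam ^ Suc a * \<kappa> ^ k = C * \<kappa> ^ (a + k) / lam ^ Suc a"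
      unfolding power_add by simp
    then show ?thesis using a k by linarith
  qed
  have "eventually (\<lambda>L. surv {0<..<Suc L} (nat \<lfloor>real L * \<tau>1\<rfloor>) {[0]} [0] < e) sequentially"
    using surv_above_root_tendsto_0[OF \<tau>1(1)] e by (rule order_tendstoD)
  moreover have "eventually (\<lambda>L. r * Suc a \<le> L) sequentially" by (rule eventually_ge_at_top)
  moreover have "eventually (\<lambda>L. (real (r * (a + k)) + 1) / (\<tau> - \<tau>1) \<le> real L) sequentially"
    using filterlim_real_sequentially by (simp add: filterlim_at_top)
  ultimately show ?thesis
  proof eventually_elim
    case (elim L)
    have "newmax_bound L (nat \<lfloor>real L * \<tau>1\<rfloor> + r * (a + k)) ((e + e) / \<beta> + (1 - \<beta>) ^ r)"
      using ak e elim by (intro newmax_bound_iterate) auto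
    moreover have "(e + e) / \<beta> + (1 - \<beta>) ^ r \<le> \<eta>" using r \<beta>_pos by (simp add: e_def)
    moreover have "nat \<lfloor>real L * \<tau>1\<rfloor> + r * (a + k) \<le> nat \<lfloor>real L * \<tau>\<rfloor>"
    proof -
      have "0 < \<tau>1" using \<tau>1 S_pos less_trans[of 0 "1 / S" \<tau>1] by simp
      then have "real (nat \<lfloor>real L * \<tau>1\<rfloor>) \<le> real L * \<tau>1" by simp
      moreover have "real (r * (a + k)) + 1 \<le> real L * \<tau> - real L * \<tau>1"
        using elim(3) \<tau>1 by (simp add: field_simps)
      ultimately have "real (nat \<lfloor>real L * \<tau>1\<rfloor> + r * (a + k)) \<le> real L * \<tau>" by simp
      then show ?thesis by (rule le_nat_floor)
    qed
    ultimately show ?case by (meson newmax_bound_mono)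
  qed
qed

text \<open>The largest base to which \<open>EM_le_U\<close> applies.\<close>

definition w :: real where "w = 1 / \<kappa>"

lemma w_gt_1: "1 < w" and w_pos: "0 < w" and w_\<kappa>: "w * \<kappa> = 1"
  using \<kappa> by (auto simp: w_def)

text \<open>With base \<open>w powr (1 / L)\<close> a block finished in time
  \<open>L * \<tau>\<close> contributes at most \<open>w powr \<tau>\<close>, independently of
  \<open>L\<close>; slow blocks are made negligible by \<open>newmax_bound\<close> and by the moment
  at base \<open>w\<close>.\<close>

lemma EM_block:
  assumes \<tau>': "1 / S < \<tau>'"
  obtains L where "1 \<le> L"
    "\<And>m V y n. 1 \<le> m \<Longrightarrow> newmax m V y \<Longrightarrow> EM (w powr (1 / real L)) (m + L) n V y \<le> w powr \<tau>'"
proof -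
  obtain \<tau> where \<tau>: "1 / S < \<tau>" "\<tau> < \<tau>'" using \<tau>' dense by blast
  have \<tau>_pos: "0 < \<tau>" using \<tau> S_pos less_trans[of 0 "1 / S" \<tau>] by simp
  have \<kappa>0: "(\<lambda>n. \<kappa> ^ n) \<longlonglongrightarrow> 0" using \<kappa> by (intro LIMSEQ_power_zero) auto
  \<comment> \<open>Truncation at \<open>u = k * L\<close> leaves a tail of order
    \<open>(\<kappa> ^ k / lam) ^ L\<close>, so this ratio must be below
    \<open>1 / 2\<close>.\<close>
  then have "eventually (\<lambda>k. \<kappa> ^ k < lam / 2) sequentially" using lam by (intro order_tendstoD) auto
  then obtain k where k: "\<kappa> ^ k < lam / 2" by (auto simp: eventually_sequentially)
  \<comment> \<open>The two error terms, each at most \<open>w ^ k * g\<close>, together fill the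
    gap between \<open>w powr \<tau>\<close> and \<open>w powr \<tau>'\<close>.\<close>
  define g where "g = (w powr \<tau>' - w powr \<tau>) / (2 * w ^ k)"
  have g: "0 < g" using \<tau> w_gt_1 by (simp add: g_def)
  have "(\<lambda>L. C * (1 / 2) ^ L) \<longlonglongrightarrow> C * 0" by (intro tendsto_mult_left LIMSEQ_power_zero) auto
  then have "eventually (\<lambda>L. C * (1 / 2) ^ L < g) sequentially" using g by (intro order_tendstoD) auto
  moreover have "eventually (\<lambda>L. newmax_bound L (nat \<lfloor>real L * \<tau>\<rfloor>) g) sequentially"
    by (rule newmax_bound_eventually[OF \<tau>(1) g])
  moreover have "eventually (\<lambda>L::nat. 1 \<le> L) sequentially" by (rule eventually_ge_at_top)
  ultimately have "eventually (\<lambda>L. C * (1 / 2) ^ L < g \<and> newmax_bound L (nat \<lfloor>real L * \<tau>\<rfloor>) g \<and> 1 \<le> L) sequentially"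
    by eventually_elim auto
  then obtain L where L: "C * (1 / 2) ^ L < g" "newmax_bound L (nat \<lfloor>real L * \<tau>\<rfloor>) g" "1 \<le> L"
    by (auto simp: eventually_sequentially)
  define z where "z = w powr (1 / real L)"
  have z1: "1 \<le> z" using w_gt_1 by (simp add: z_def ge_one_powr_ge_zero)
  have zw: "z \<le> w" using w_gt_1 L(3) powr_mono[of "1 / real L" 1 w] by (simp add: z_def)
  have z_pow: "z ^ u = w powr (real u / real L)" for u
    using w_pos by (simp add: z_def powr_powr flip: powr_realpow)
  have zkL: "z ^ (k * L) = w ^ k" using L(3) w_pos by (simp add: z_pow powr_realpow)
  have "EM z (m + L) n V y \<le> w powr \<tau>'" if m: "1 \<le> m" and rec: "newmax m V y" for m V y n
  proof -
    let ?t = "nat \<lfloor>real L * \<tau>\<rfloor>" and ?u = "k * L"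
    have gd: "good V y" and ly: "length y = m" using rec by (auto simp: newmax_def)
    have "EM z (m + L) n V y \<le> z ^ ?t + (z ^ ?u * sv (m + L) ?t V y + (z / w) ^ ?u * EM w (m + L) n V y)"
      by (rule EM_truncate[OF z1 zw])
    also have "\<dots> \<le> w powr \<tau> + (w ^ k * g + w ^ k * g)"
    proof (intro add_mono)
      have "real ?t \<le> real L * \<tau>" using \<tau>_pos by simp
      then have "real ?t / real L \<le> \<tau>" using L(3) by (simp add: field_simps)
      then show "z ^ ?t \<le> w powr \<tau>" unfolding z_pow using w_gt_1 by (intro powr_mono) auto
      show "z ^ ?u * sv (m + L) ?t V y \<le> w ^ k * g"
        using L(2) m rec w_pos unfolding zkL newmax_bound_def by (intro mult_left_mono) auto
      have "EM w (m + L) n V y \<le> U n V y / lam ^ (m + L)"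
        using w_pos w_\<kappa> gd ly by (intro EM_le_U) auto
      also have "\<dots> \<le> C * lam ^ m / lam ^ (m + L)" using U_le[OF gd, of n] ly lam by (intro divide_right_mono) auto
      also have "\<dots> = C / lam ^ L" using lam by (simp add: power_add)
      finally have "(z / w) ^ ?u * EM w (m + L) n V y \<le> (z / w) ^ ?u * (C / lam ^ L)"
        using z1 w_pos by (intro mult_left_mono) auto
      also have "\<dots> = w ^ k * (C * (\<kappa> ^ k / lam) ^ L)"
      proof -
        have "(z / w) ^ ?u = w ^ k * \<kappa> ^ ?u" unfolding power_divide zkL by (simp add: w_def power_one_over)
        also have "\<kappa> ^ ?u = (\<kappa> ^ k) ^ L" by (rule power_mult)
        finally show ?thesis by (simp add: power_divide)
      qed
      also have "\<dots> \<le> w ^ k * (C * (1 / 2) ^ L)"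
        using k lam \<kappa> C_ge_1 w_pos by (intro mult_left_mono power_mono) (auto simp: field_simps)
      also have "\<dots> \<le> w ^ k * g" using L(1) w_pos by (intro mult_left_mono) auto
      finally show "(z / w) ^ ?u * EM w (m + L) n V y \<le> w ^ k * g" .
    qed
    also have "\<dots> = w powr \<tau>'" using w_pos by (simp add: g_def field_simps)
    finally show ?thesis .
  qed
  then show ?thesis using that[OF L(3)] by (simp add: z_def)
qed

lemma mass_exponential_decay:
  assumes \<epsilon>: "0 < \<epsilon>" "\<epsilon> < S"
  obtains \<gamma> K where "0 < \<gamma>" "0 < K"
    "\<And>n. mass {h. real h \<le> (S - \<epsilon>) * real n} n {} [] \<le> K * exp (- \<gamma> * real n)"
proof -
  \<comment> \<open>By time \<open>n\<close> the walk should have reached level about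
    \<open>v * n\<close>. As \<open>\<tau> * v < 1\<close>, the moment bound for
    \<open>v * n / L\<close> blocks grows more slowly than \<open>z ^ n\<close>.\<close>
  define v where "v = S - \<epsilon> / 2"
  have v: "0 < v" "v < S" using \<epsilon> by (auto simp: v_def)
  then have "1 / S < 1 / v" by (simp add: field_simps)
  then obtain \<tau> where \<tau>: "1 / S < \<tau>" "\<tau> < 1 / v" using dense by blast
  have \<tau>_pos: "0 < \<tau>" using \<tau> S_pos less_trans[of 0 "1 / S" \<tau>] by simp
  have \<tau>v: "\<tau> * v < 1" using \<tau> v by (simp add: field_simps)
  obtain L where L: "1 \<le> L"
    and blk: "\<And>m V y n. 1 \<le> m \<Longrightarrow> newmax m V y \<Longrightarrow> EM (w powr (1 / real L)) (m + L) n V y \<le> w powr \<tau>"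
    using EM_block[OF \<tau>(1)] by blast
  define z where "z = w powr (1 / real L)"
  have z_pos: "0 < z" using w_pos by (simp add: z_def)
  have zw: "z \<le> w" using w_gt_1 L powr_mono[of "1 / real L" 1 w] by (simp add: z_def)
  have z_pow: "z ^ u = w powr (real u / real L)" for u
    using w_pos by (simp add: z_def powr_powr flip: powr_realpow)
  have K1: "1 \<le> w powr \<tau>" using w_gt_1 \<tau>_pos by (simp add: ge_one_powr_ge_zero)
  \<comment> \<open>Blocks start from level 1 because the block bound needs
    \<open>1 \<le> m\<close>; the climb to level 1 costs the factor \<open>C / lam\<close>.\<close>
  have chain: "EM z (1 + i * L) n {} [] \<le> C / lam * w powr (\<tau> * real i)" for i n
  proof (induction i)
    case 0
    have "z * \<kappa> \<le> 1" using zw \<kappa> w_\<kappa> mult_right_mono[of z w \<kappa>] by simp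
    then have "EM z 1 n {} [] \<le> U n {} [] / lam ^ 1" using z_pos good_start by (intro EM_le_U) auto
    also have "\<dots> \<le> C / lam" using U_le[OF good_start, of n] lam by (simp add: divide_right_mono)
    finally show ?case using w_pos by simp
  next
    case (Suc i)
    have "EM z (1 + i * L + L) n {} [] \<le> w powr \<tau> * EM z (1 + i * L) n {} []"
      by (rule EM_split_at_level[where l="1 + i * L"]) (use blk[of "1 + i * L"] K1 z_pos in \<open>auto simp: z_def below_start\<close>)
    also have "\<dots> \<le> w powr \<tau> * (C / lam * w powr (\<tau> * real i))" using Suc w_pos by (intro mult_left_mono) auto
    finally show ?case using w_pos by (simp add: algebra_simps powr_add)
  qed
  have sv_bound: "sv (1 + i * L) n {} [] \<le> C / lam * w powr (\<tau> * real i - real n / real L)" for i n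
  proof -
    have "sv (1 + i * L) n {} [] * z ^ n \<le> C / lam * w powr (\<tau> * real i)"
      using sv_le_EM[of z n "1 + i * L" "{}" "[]"] chain[of i n] z_pos by (simp only: mult.commute) linarith
    then have "sv (1 + i * L) n {} [] \<le> C / lam * w powr (\<tau> * real i) / z ^ n"
      using z_pos by (simp only: pos_le_divide_eq zero_less_power)
    then show ?thesis unfolding z_pow by (simp only: powr_diff times_divide_eq_right)
  qed
  \<comment> \<open>\<open>\<gamma>1\<close> is the rate for climbing too slowly,
    \<open>\<gamma>2\<close> for descending \<open>\<epsilon> / 2 * n\<close> levels. In
    \<open>K\<close> the factor \<open>w powr \<tau>\<close> pays for rounding up the number of
    blocks.\<close>
  define \<gamma>1 where "\<gamma>1 = ln w * (1 - \<tau> * v) / real L"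
  define \<gamma>2 where "\<gamma>2 = - ln q * (\<epsilon> / 2)"
  define K where "K = C / lam * w powr \<tau> + 1"
  have \<gamma>: "0 < \<gamma>1" "0 < \<gamma>2" using w_gt_1 \<tau>v L q \<epsilon> by (auto simp: \<gamma>1_def \<gamma>2_def mult_neg_pos)
  have K0: "0 \<le> C / lam * w powr \<tau>" using C_ge_1 lam by simp
  have "mass {h. real h \<le> (S - \<epsilon>) * real n} n {} [] \<le> K * exp (- min \<gamma>1 \<gamma>2 * real n)" for n
  proof -
    define i where "i = nat \<lceil>v * real n / real L\<rceil>"
    define j where "j = nat \<lfloor>(S - \<epsilon>) * real n\<rfloor>"
    have vn: "0 \<le> v * real n / real L" using v by simp
    have i: "v * real n / real L \<le> real i" "real i \<le> v * real n / real L + 1"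
      unfolding i_def using vn by linarith+
    have iL: "v * real n \<le> real (1 + i * L)" using i(1) L by (simp add: field_simps)
    have j: "real j \<le> (S - \<epsilon>) * real n" using \<epsilon> by (simp add: j_def)
    have "(S - \<epsilon>) * real n + \<epsilon> / 2 * real n = v * real n" by (simp add: v_def algebra_simps)
    then have gap: "\<epsilon> / 2 * real n \<le> real (1 + i * L) - real j" using iL j by linarith
    have "0 \<le> \<epsilon> / 2 * real n" using \<epsilon> by simp
    then have "real j \<le> real (1 + i * L)" using gap by linarith
    then have jM: "j \<le> 1 + i * L" by (simp only: of_nat_le_iff)
    have "mass {h. real h \<le> (S - \<epsilon>) * real n} n {} [] \<le> mass {..j} n {} []"
      by (rule mass_mono) (auto simp: j_def le_nat_floor)
    also have "\<dots> \<le> sv (1 + i * L) n {} [] + q ^ (1 + i * L - j)"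
      by (rule mass_le_sv[OF jM good_start]) simp
    also have "sv (1 + i * L) n {} [] \<le> C / lam * w powr (\<tau> - (1 - \<tau> * v) * real n / real L)"
    proof -
      have "\<tau> * real i \<le> \<tau> * (v * real n / real L + 1)" using i(2) \<tau>_pos by (intro mult_left_mono) auto
      then have "\<tau> * real i - real n / real L \<le> \<tau> - (1 - \<tau> * v) * real n / real L"
        using L by (simp add: field_simps)
      then have "w powr (\<tau> * real i - real n / real L) \<le> w powr (\<tau> - (1 - \<tau> * v) * real n / real L)"
        using w_gt_1 by (intro powr_mono) auto
      then have "C / lam * w powr (\<tau> * real i - real n / real L)
          \<le> C / lam * w powr (\<tau> - (1 - \<tau> * v) * real n / real L)"
        using C_ge_1 lam by (intro mult_left_mono) auto
      then show ?thesis using sv_bound[of i n] by linarith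
    qed
    also have "\<dots> = C / lam * w powr \<tau> * exp (- \<gamma>1 * real n)"
    proof -
      have "w powr (\<tau> - (1 - \<tau> * v) * real n / real L) = w powr \<tau> * w powr (- ((1 - \<tau> * v) * real n / real L))"
        by (simp flip: powr_add)
      also have "w powr (- ((1 - \<tau> * v) * real n / real L)) = exp (- \<gamma>1 * real n)"
        using w_pos by (simp add: powr_def \<gamma>1_def mult_ac)
      finally show ?thesis by simp
    qed
    also have "\<dots> \<le> C / lam * w powr \<tau> * exp (- min \<gamma>1 \<gamma>2 * real n)"
      using K0 by (intro mult_left_mono) (auto intro: mult_right_mono)
    also have "q ^ (1 + i * L - j) = q powr (real (1 + i * L) - real j)"
      using q jM by (simp add: of_nat_diff flip: powr_realpow)
    also have "\<dots> \<le> q powr (\<epsilon> / 2 * real n)" using gap q by (intro powr_mono') auto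
    also have "\<dots> = exp (- \<gamma>2 * real n)" using q by (simp add: powr_def \<gamma>2_def)
    also have "\<dots> \<le> exp (- min \<gamma>1 \<gamma>2 * real n)" by (auto intro: mult_right_mono)
    finally show ?thesis by (simp add: K_def algebra_simps)
  qed
  moreover have "0 < K" using K0 by (simp add: K_def)
  ultimately show ?thesis using that[of "min \<gamma>1 \<gamma>2" K] \<gamma> by auto
qed

end

end

section \<open>Oscillation between the root and its first child\<close>

lemma (in reinforced_tree) mass_ge_power:
  "y = [] \<or> y = [0] \<Longrightarrow> (1 / (c * (real b + 1))) ^ n \<le> mass {..1} n V y"
proof (induction n arbitrary: V y)
  case (Suc n)
  let ?p = "1 / (c * (real b + 1))"
  have p: "0 \<le> ?p" using c_gt_1 by simp
  show ?case
  proof (cases "y = []")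
    case True
    have "?p * ?p ^ n \<le> ?p * mass {..1} n (insert [0] V) [0]"
      using p Suc.IH[of "[0]"] by (intro mult_left_mono) auto
    also have "\<dots> \<le> avg (mass {..1} n) V y"
      using avg_ge_child[of "mass {..1} n" 0 y V] mass_nonneg b_ge_2 True by simp
    finally show ?thesis by simp
  next
    case False
    then have y: "y = [0]" using Suc.prems by simp
    have "?p * ?p ^ n \<le> ?p * mass {..1} n V []"
      using p Suc.IH[of "[]"] by (intro mult_left_mono) auto
    also have "\<dots> \<le> avg (mass {..1} n) V y"
      using avg_ge_parent[of "mass {..1} n" y V] mass_nonneg y by simp
    finally show ?thesis by simp
  qed
qed auto

section \<open>The law of the walk\<close>

locale walk_on_tree = once_reinforced_walk M b c Y + reinforced_tree b c
  for M :: "'w measure" and b c Y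
begin

definition hist :: "nat \<Rightarrow> 'w \<Rightarrow> nat list list" where
  "hist n \<omega> = map (\<lambda>i. Y i \<omega>) [0..<Suc n]"

definition visited :: "nat list list \<Rightarrow> nat list set" where
  "visited l = set l - {[]}"

primrec paths :: "nat \<Rightarrow> nat list list set" where
  "paths 0 = {[[]]}"
| "paths (Suc n) = (\<lambda>(l, y). l @ [y]) ` (SIGMA l:paths n. tree_nbrs b (last l))"

text \<open>Finitely many histories are possible, so expectations are finite sums. That
  \<open>paths\<close> carries the full mass follows from \<open>expect_1\<close>.\<close>

definition expect :: "nat \<Rightarrow> (nat list list \<Rightarrow> real) \<Rightarrow> real" where
  "expect n f = (\<Sum>l\<in>paths n. prob {\<omega> \<in> space M. hist n \<omega> = l} * f l)"

lemma hist_Suc: "hist (Suc n) \<omega> = hist n \<omega> @ [Y (Suc n) \<omega>]"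
  by (simp add: hist_def)

lemma hist_nth: "i \<le> n \<Longrightarrow> hist n \<omega> ! i = Y i \<omega>"
  unfolding hist_def by (subst nth_map) (simp_all del: upt_Suc)

lemma length_hist: "length (hist n \<omega>) = Suc n"
  unfolding hist_def by (simp del: upt_Suc)

lemma hist_eq_iff:
  assumes "length l = Suc n"
  shows "hist n \<omega> = l \<longleftrightarrow> (\<forall>i\<le>n. Y i \<omega> = l ! i)"
proof
  assume "\<forall>i\<le>n. Y i \<omega> = l ! i"
  then show "hist n \<omega> = l"
    using assms by (intro nth_equalityI) (simp_all add: length_hist hist_nth less_Suc_eq_le)
qed (auto simp: hist_nth)

lemma hist_measurable [measurable]: "hist n \<in> measurable M (count_space UNIV)"
proof -
  have "{\<omega> \<in> space M. hist n \<omega> = l} \<in> sets M" for l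
  proof (cases "length l = Suc n")
    case True
    note [measurable] = measurable_walk
    have "{\<omega> \<in> space M. \<forall>i\<le>n. Y i \<omega> = l ! i} \<in> sets M" by measurable
    then show ?thesis by (simp only: hist_eq_iff[OF True])
  next
    case False
    then have "{\<omega> \<in> space M. hist n \<omega> = l} = {}" by (auto simp: hist_def simp del: upt_Suc)
    then show ?thesis by (simp only: sets.empty_sets)
  qed
  moreover have "hist n -` {l} \<inter> space M = {\<omega> \<in> space M. hist n \<omega> = l}" for l by blast
  ultimately show ?thesis
    unfolding measurable_count_space_eq2_countable by (simp only: Pi_UNIV UNIV_I ball_UNIV) simp
qed

text \<open>A vertex is first entered from its parent, so each visited non-root vertex has its
  parent edge traversed. This is what lets the visited set replace the set of traversed
  edges.\<close>

lemma path_properties: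
  "l \<in> paths n \<Longrightarrow> length l = Suc n \<and> good (visited l) (last l) \<and>
     (\<forall>y\<in>visited l. \<exists>i<n. {l ! i, l ! Suc i} = {tl y, y})"
proof (induction n arbitrary: l)
  case 0
  then show ?case by (simp add: visited_def good_start)
next
  case (Suc n)
  then obtain l' y where l: "l = l' @ [y]" and l': "l' \<in> paths n" and y: "y \<in> tree_nbrs b (last l')" by auto
  note IH = Suc.IH[OF l']
  from IH have len: "length l' = Suc n" by (rule conjunct1)
  from IH have gd: "good (visited l') (last l')" by (elim conjE)
  have last_l': "l' ! n = last l'" using len by (cases l' rule: rev_cases) (simp_all add: nth_append)
  have old: "\<exists>i<Suc n. {l ! i, l ! Suc i} = {tl x, x}" if "x \<in> visited l'" for x
  proof -
    obtain i where i: "i < n" "{l' ! i, l' ! Suc i} = {tl x, x}" using IH \<open>x \<in> visited l'\<close> by blast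
    have "l ! i = l' ! i" "l ! Suc i = l' ! Suc i" using i(1) len by (simp_all add: l nth_append)
    then have "{l ! i, l ! Suc i} = {tl x, x}" using i(2) by (simp only:)
    moreover have "i < Suc n" using i(1) by simp
    ultimately show ?thesis by (intro exI[of _ i] conjI)
  qed
  have "(y = [] \<or> y \<in> visited l') \<and> visited l = visited l' \<or>
      (\<exists>i<b. y = i # last l') \<and> visited l = insert y (visited l')"
  proof -
    from y obtain i where i: "y = i # last l' \<or> last l' = i # y" and yt: "set y \<subseteq> {..<b}"
      by (auto simp: tree_nbrs_def tree_vertices_def)
    from i show ?thesis
    proof
      assume "y = i # last l'"
      then show ?thesis using yt by (auto simp: l visited_def)
    next
      assume 1: "last l' = i # y"
      then have "y = [] \<or> y \<in> visited l'" using gd by (auto simp: good_def tree_def)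
      then show ?thesis by (auto simp: l visited_def)
    qed
  qed
  then show ?case
  proof
    assume A: "(y = [] \<or> y \<in> visited l') \<and> visited l = visited l'"
    then have "good (visited l) (last l)" using gd by (simp add: l good_def)
    moreover have "length l = Suc (Suc n)" using len by (simp add: l)
    ultimately show ?case using old A by metis
  next
    assume A: "(\<exists>i<b. y = i # last l') \<and> visited l = insert y (visited l')"
    then obtain i where i: "i < b" "y = i # last l'" by auto
    have "good (visited l) y" using A gd i by (auto simp: good_def tree_insert)
    moreover have "{l ! n, l ! Suc n} = {tl y, y}" using len last_l' i by (simp add: l nth_append)
    then have "\<exists>i<Suc n. {l ! i, l ! Suc i} = {tl y, y}" by (intro exI[of _ n] conjI lessI)
    moreover have "length l = Suc (Suc n)" "last l = y" using len by (simp_all add: l)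
    ultimately show ?case using A old by (metis insertE)
  qed
qed

lemma path_length: "l \<in> paths n \<Longrightarrow> length l = Suc n"
  and path_good: "l \<in> paths n \<Longrightarrow> good (visited l) (last l)"
  and path_edge: "l \<in> paths n \<Longrightarrow> y \<in> visited l \<Longrightarrow> \<exists>i<n. {l ! i, l ! Suc i} = {tl y, y}"
  using path_properties by blast+

lemma path_nth_last: "l \<in> paths n \<Longrightarrow> l ! n = last l"
  using path_length[of l n] by (cases l rule: rev_cases) (auto simp: nth_append)

lemma edge_weight_path:
  assumes "l \<in> paths n"
  shows "edge_weight c (\<lambda>i. l ! i) n {x, i # x} = wt (visited l) (i # x)"
proof -
  have "(\<exists>k<n. {l ! k, l ! Suc k} = {x, i # x}) \<longleftrightarrow> i # x \<in> visited l"
  proof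
    assume "\<exists>k<n. {l ! k, l ! Suc k} = {x, i # x}"
    then obtain k where "k < n" "i # x = l ! k \<or> i # x = l ! Suc k" by (metis insertI1 insertI2 insertE singletonD)
    then have "i # x \<in> set l" using path_length[OF assms] by (metis Suc_mono less_SucI nth_mem)
    then show "i # x \<in> visited l" by (simp add: visited_def)
  qed (use path_edge[OF assms, of "i # x"] in simp)
  then show ?thesis by (simp add: edge_weight_def wt_def)
qed

lemma last_path_tree:
  assumes "l \<in> paths n"
  shows "last l \<in> tree_vertices b"
proof (cases n)
  case 0
  then show ?thesis using assms by (simp add: tree_vertices_def)
next
  case (Suc m)
  then show ?thesis using assms by (auto simp: tree_nbrs_def)
qed

lemma sum_tree_nbrs:
  assumes "x \<in> tree_vertices b"
  shows "(\<Sum>y\<in>tree_nbrs b x. f y) = (if x = [] then 0 else f (tl x)) + (\<Sum>i<b. f (i # x) :: real)"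
proof (cases x)
  case Nil
  then show ?thesis by (simp add: tree_nbrs_Nil sum.reindex inj_on_def)
next
  case (Cons j z)
  have "z \<notin> (\<lambda>i. i # j # z) ` {..<b}"
  proof
    assume "z \<in> (\<lambda>i. i # j # z) ` {..<b}"
    then obtain i where "z = i # j # z" by blast
    then have "length z = length (i # j # z)" by (rule arg_cong)
    then show False by simp
  qed
  then show ?thesis using assms unfolding Cons by (simp add: tree_nbrs_Cons sum.reindex inj_on_def)
qed

text \<open>This identifies the transition law of the walk with \<open>avg\<close>: given the
  history, the next step depends only on visited set and position.\<close>

lemma sum_step_prob:
  assumes l: "l \<in> paths n"
  shows "(\<Sum>y\<in>tree_nbrs b (last l). step_prob b c (\<lambda>i. l ! i) n y * G (visited (l @ [y])) y)
    = avg G (visited l) (last l)"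
proof -
  let ?x = "last l" and ?V = "visited l"
  let ?w = "\<lambda>y. edge_weight c (\<lambda>i. l ! i) n {?x, y}"
  note tree = last_path_tree[OF l]
  have child: "?w (i # ?x) = wt ?V (i # ?x)" for i by (rule edge_weight_path[OF l])
  have parent: "?w (tl ?x) = c" and par_vis: "visited (l @ [tl ?x]) = ?V" if "?x \<noteq> []"
  proof -
    obtain j z where x: "?x = j # z" using \<open>?x \<noteq> []\<close> by (cases ?x) auto
    have gd: "good ?V ?x" by (rule path_good[OF l])
    then have "?x \<in> ?V" using that by (simp add: good_def)
    have "{?x, tl ?x} = {z, j # z}" using x by auto
    then show "?w (tl ?x) = c" using edge_weight_path[OF l, of z j] \<open>?x \<in> ?V\<close> x by (simp add: wt_def)
    have "z = [] \<or> z \<in> ?V" using gd x by (auto simp: good_def tree_def)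
    then show "visited (l @ [tl ?x]) = ?V" using x by (auto simp: visited_def)
  qed
  have tot: "(\<Sum>y\<in>tree_nbrs b ?x. ?w y) = total_wt ?V ?x"
    unfolding sum_tree_nbrs[OF tree] total_wt_def child using parent by simp
  have "(\<Sum>y\<in>tree_nbrs b ?x. step_prob b c (\<lambda>i. l ! i) n y * G (visited (l @ [y])) y)
      = (\<Sum>y\<in>tree_nbrs b ?x. ?w y * G (visited (l @ [y])) y / total_wt ?V ?x)"
    by (intro sum.cong refl) (simp add: step_prob_def path_nth_last[OF l] tot)
  also have "\<dots> = (\<Sum>y\<in>tree_nbrs b ?x. ?w y * G (visited (l @ [y])) y) / total_wt ?V ?x"
    by (rule sum_divide_distrib[symmetric])
  also have "visited (l @ [i # ?x]) = insert (i # ?x) ?V" for i by (auto simp: visited_def)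
  then have "(\<Sum>y\<in>tree_nbrs b ?x. ?w y * G (visited (l @ [y])) y) / total_wt ?V ?x = avg G ?V ?x"
    unfolding sum_tree_nbrs[OF tree] avg_def child using parent par_vis by simp
  finally show ?thesis .
qed

lemma finite_paths: "finite (paths n)"
proof (induction n)
  case (Suc n)
  then show ?case using finite_tree_nbrs last_path_tree by (auto intro!: finite_imageI finite_SigmaI)
qed simp

lemma prob_hist_Suc:
  assumes l: "l \<in> paths n"
  shows "prob {\<omega> \<in> space M. hist (Suc n) \<omega> = l @ [y]}
    = prob {\<omega> \<in> space M. hist n \<omega> = l} * step_prob b c (\<lambda>i. l ! i) n y"
proof -
  have H: "hist n \<omega> = l \<longleftrightarrow> (\<forall>i\<le>n. Y i \<omega> = l ! i)" for \<omega>
    by (rule hist_eq_iff) (rule path_length[OF l])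
  have H': "hist (Suc n) \<omega> = l @ [y] \<longleftrightarrow> Y (Suc n) \<omega> = y \<and> hist n \<omega> = l" for \<omega>
    by (auto simp: hist_Suc)
  show ?thesis
  proof (cases "prob {\<omega> \<in> space M. hist n \<omega> = l} > 0")
    case True
    then show ?thesis using step[of n "\<lambda>i. l ! i" y] unfolding H' H cond_prob_def by (simp add: field_simps)
  next
    case False
    \<comment> \<open>The step law is given only on histories of positive probability; on the others
      both sides vanish.\<close>
    then have 0: "prob {\<omega> \<in> space M. hist n \<omega> = l} = 0" using measure_nonneg[of M] by (metis antisym_conv1)
    have "prob {\<omega> \<in> space M. hist (Suc n) \<omega> = l @ [y]} \<le> prob {\<omega> \<in> space M. hist n \<omega> = l}"
      by (intro finite_measure_mono) (auto simp: H')
    then show ?thesis using 0 measure_nonneg[of M "{\<omega> \<in> space M. hist (Suc n) \<omega> = l @ [y]}"] by simp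
  qed
qed

lemma expect_Suc:
  "expect (Suc n) f = expect n (\<lambda>l. \<Sum>y\<in>tree_nbrs b (last l). step_prob b c (\<lambda>i. l ! i) n y * f (l @ [y]))"
proof -
  have "expect (Suc n) f = (\<Sum>(l, y)\<in>(SIGMA l:paths n. tree_nbrs b (last l)).
      prob {\<omega> \<in> space M. hist (Suc n) \<omega> = l @ [y]} * f (l @ [y]))"
    unfolding expect_def paths.simps by (subst sum.reindex) (auto simp: inj_on_def case_prod_beta)
  also have "\<dots> = (\<Sum>l\<in>paths n. \<Sum>y\<in>tree_nbrs b (last l).
      prob {\<omega> \<in> space M. hist (Suc n) \<omega> = l @ [y]} * f (l @ [y]))"
    using finite_paths finite_tree_nbrs last_path_tree by (subst sum.Sigma) auto
  also have "\<dots> = expect n (\<lambda>l. \<Sum>y\<in>tree_nbrs b (last l). step_prob b c (\<lambda>i. l ! i) n y * f (l @ [y]))"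
    unfolding expect_def by (intro sum.cong refl) (simp add: prob_hist_Suc sum_distrib_left mult_ac)
  finally show ?thesis .
qed

text \<open>The factor \<open>\<phi>\<close> depends only on the history up to time
  \<open>n\<close>, so it comes out of the last step.\<close>

lemma expect_markov:
  "expect (Suc n) (\<lambda>l. \<phi> (butlast l) * G (visited l) (last l))
    = expect n (\<lambda>l. \<phi> l * avg G (visited l) (last l))"
  unfolding expect_Suc unfolding expect_def
  by (intro sum.cong refl) (simp add: sum_step_prob[symmetric] sum_distrib_left mult_ac)

lemma expect_0: "expect 0 f = f [[]]"
proof -
  have "AE \<omega> in M. hist 0 \<omega> = [[]]" using start by eventually_elim (simp add: hist_def)
  then have "prob {\<omega> \<in> space M. hist 0 \<omega> = [[]]} = 1" by (subst prob_Collect_eq_1) auto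
  then show ?thesis by (simp add: expect_def)
qed

lemma expect_eq_funpow: "expect n (\<lambda>l. G (visited l) (last l)) = (avg ^^ n) G {} []"
proof (induction n arbitrary: G)
  case 0
  then show ?case by (simp add: expect_0 visited_def)
next
  case (Suc n)
  have "expect (Suc n) (\<lambda>l. G (visited l) (last l)) = expect n (\<lambda>l. avg G (visited l) (last l))"
    using expect_markov[of n "\<lambda>_. 1" G] by simp
  also have "\<dots> = (avg ^^ Suc n) G {} []" unfolding Suc by (simp add: funpow_swap1)
  finally show ?case .
qed

lemma expect_1: "expect n (\<lambda>_. 1) = 1"
proof -
  have "(avg ^^ n) (\<lambda>_ _. 1) = (\<lambda>_ _. 1)" by (induction n) (auto intro!: ext)
  then show ?thesis using expect_eq_funpow[of n "\<lambda>_ _. 1"] by simp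
qed

lemma prob_hist_in:
  assumes "finite A"
  shows "prob {\<omega> \<in> space M. hist n \<omega> \<in> A} = (\<Sum>l\<in>A. prob {\<omega> \<in> space M. hist n \<omega> = l})"
proof -
  have "{\<omega> \<in> space M. hist n \<omega> \<in> A} = (\<Union>l\<in>A. {\<omega> \<in> space M. hist n \<omega> = l})" by auto
  also have "prob \<dots> = (\<Sum>l\<in>A. prob {\<omega> \<in> space M. hist n \<omega> = l})"
    using assms by (intro finite_measure_finite_Union) (auto simp: disjoint_family_on_def)
  finally show ?thesis .
qed

lemma prob_hist: "prob {\<omega> \<in> space M. Q (hist n \<omega>)} = expect n (\<lambda>l. of_bool (Q l))"
proof -
  have "prob {\<omega> \<in> space M. hist n \<omega> \<in> paths n} = 1"
    using expect_1[of n] prob_hist_in[OF finite_paths] by (simp add: expect_def)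
  then have "AE \<omega> in M. hist n \<omega> \<in> paths n" by (subst (asm) prob_Collect_eq_1) auto
  then have "prob {\<omega> \<in> space M. Q (hist n \<omega>)} = prob {\<omega> \<in> space M. hist n \<omega> \<in> {l \<in> paths n. Q l}}"
    by (intro finite_measure_eq_AE) auto
  also have "\<dots> = (\<Sum>l\<in>{l \<in> paths n. Q l}. prob {\<omega> \<in> space M. hist n \<omega> = l})"
    using finite_paths by (intro prob_hist_in) auto
  also have "\<dots> = expect n (\<lambda>l. of_bool (Q l))"
    unfolding expect_def using finite_paths by (intro sum.mono_neutral_cong_left) auto
  finally show ?thesis .
qed

lemma last_hist: "last (hist n \<omega>) = Y n \<omega>"
  by (simp add: hist_def)

lemma prob_height: "prob {\<omega> \<in> space M. length (Y n \<omega>) \<in> A} = mass A n {} []"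
proof -
  have "mass A n = (avg ^^ n) (mass A 0)" by (induction n) auto
  moreover have "prob {\<omega> \<in> space M. length (Y n \<omega>) \<in> A} = expect n (\<lambda>l. mass A 0 (visited l) (last l))"
    using prob_hist[of "\<lambda>l. length (last l) \<in> A" n] by (simp add: last_hist of_bool_def)
  ultimately show ?thesis by (simp only: expect_eq_funpow)
qed

text \<open>Each induction step moves one time of avoiding the root from the survival function into
  the indicator on the history, keeping \<open>m + k\<close> fixed.\<close>

lemma expect_avoids_root:
  "expect (N + m) (\<lambda>l. of_bool (\<forall>i. N \<le> i \<and> i < N + m \<longrightarrow> l ! i \<noteq> []) * surv {0<..} k (visited l) (last l))
    = (avg ^^ N) (surv {0<..} (m + k)) {} []"
proof (induction m arbitrary: k)
  case 0
  have *: "(\<forall>i. N \<le> i \<and> i < N + 0 \<longrightarrow> l ! i \<noteq> []) = True" for l :: "nat list list" by auto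
  show ?case using expect_eq_funpow[of N "surv {0<..} k"] unfolding * by simp
next
  case (Suc m)
  let ?\<phi> = "\<lambda>m (l :: nat list list). of_bool (\<forall>i. N \<le> i \<and> i < N + m \<longrightarrow> l ! i \<noteq> []) :: real"
  have "expect (Suc (N + m)) (\<lambda>l. ?\<phi> (Suc m) l * surv {0<..} k (visited l) (last l))
      = expect (Suc (N + m)) (\<lambda>l. ?\<phi> (Suc m) (butlast l) * surv {0<..} k (visited l) (last l))"
    unfolding expect_def
  proof (rule sum.cong[OF refl], rule arg_cong2[where f="(*)", OF refl])
    fix l assume "l \<in> paths (Suc (N + m))"
    then have "length l = Suc (Suc (N + m))" by (rule path_length)
    then have "butlast l ! i = l ! i" if "i < N + Suc m" for i using that by (simp add: nth_butlast)
    then show "?\<phi> (Suc m) l * surv {0<..} k (visited l) (last l)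
        = ?\<phi> (Suc m) (butlast l) * surv {0<..} k (visited l) (last l)" by simp
  qed
  also have "\<dots> = expect (N + m) (\<lambda>l. ?\<phi> (Suc m) l * avg (surv {0<..} k) (visited l) (last l))"
    by (rule expect_markov)
  also have "\<dots> = expect (N + m) (\<lambda>l. ?\<phi> m l * surv {0<..} (Suc k) (visited l) (last l))"
    unfolding expect_def
  proof (rule sum.cong[OF refl], rule arg_cong2[where f="(*)", OF refl])
    fix l assume "l \<in> paths (N + m)"
    then have "l ! (N + m) = last l" by (rule path_nth_last)
    then have "(\<forall>i. N \<le> i \<and> i < N + Suc m \<longrightarrow> l ! i \<noteq> [])
        \<longleftrightarrow> (\<forall>i. N \<le> i \<and> i < N + m \<longrightarrow> l ! i \<noteq> []) \<and> last l \<noteq> []"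
      by (metis add_Suc_right le_add1 less_Suc_eq)
    then show "?\<phi> (Suc m) l * avg (surv {0<..} k) (visited l) (last l)
        = ?\<phi> m l * surv {0<..} (Suc k) (visited l) (last l)"
      by auto
  qed
  also have "\<dots> = (avg ^^ N) (surv {0<..} (m + Suc k)) {} []" by (rule Suc)
  finally show ?case by simp
qed

lemma prob_avoids_root:
  "prob {\<omega> \<in> space M. \<forall>i. N \<le> i \<and> i \<le> N + m \<longrightarrow> Y i \<omega> \<noteq> []} = (avg ^^ N) (surv {0<..} m) {} []"
proof -
  have "hist (N + m) \<omega> ! i = Y i \<omega>" if "i \<le> N + m" for i \<omega>
    using that by (rule hist_nth)
  then have "{\<omega> \<in> space M. \<forall>i. N \<le> i \<and> i \<le> N + m \<longrightarrow> Y i \<omega> \<noteq> []}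
      = {\<omega> \<in> space M. \<forall>i. N \<le> i \<and> i \<le> N + m \<longrightarrow> hist (N + m) \<omega> ! i \<noteq> []}" by auto
  also have "prob \<dots> = expect (N + m) (\<lambda>l. of_bool (\<forall>i. N \<le> i \<and> i \<le> N + m \<longrightarrow> l ! i \<noteq> []))"
    by (rule prob_hist)
  also have "\<dots> = expect (N + m) (\<lambda>l. of_bool (\<forall>i. N \<le> i \<and> i < N + m \<longrightarrow> l ! i \<noteq> []) * surv {0<..} 0 (visited l) (last l))"
    unfolding expect_def
  proof (rule sum.cong[OF refl], rule arg_cong2[where f="(*)", OF refl])
    fix l assume "l \<in> paths (N + m)"
    then have "l ! (N + m) = last l" by (rule path_nth_last)
    then have "(\<forall>i. N \<le> i \<and> i \<le> N + m \<longrightarrow> l ! i \<noteq> [])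
        \<longleftrightarrow> (\<forall>i. N \<le> i \<and> i < N + m \<longrightarrow> l ! i \<noteq> []) \<and> last l \<noteq> []"
      by (metis le_add1 le_eq_less_or_eq)
    then show "of_bool (\<forall>i. N \<le> i \<and> i \<le> N + m \<longrightarrow> l ! i \<noteq> []) =
        of_bool (\<forall>i. N \<le> i \<and> i < N + m \<longrightarrow> l ! i \<noteq> []) * surv {0<..} 0 (visited l) (last l)"
      by auto
  qed
  also have "\<dots> = (avg ^^ N) (surv {0<..} m) {} []" using expect_avoids_root[of N m 0] by simp
  finally show ?thesis .
qed

section \<open>Consequences of an almost sure speed\<close>

lemma height_event [measurable]: "{\<omega> \<in> space M. Q (Y n \<omega>)} \<in> events"
  using measurable_sets[OF measurable_walk[of n], of "{y. Q y}"] by (simp add: vimage_def Int_def conj_commute)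

text \<open>Continuity from below along the increasing events that the property holds from time
  \<open>N\<close> on.\<close>

lemma prob_eventually:
  assumes "AE \<omega> in M. eventually (\<lambda>n. Q n (Y n \<omega>)) sequentially"
  shows "(\<lambda>N. prob {\<omega> \<in> space M. \<forall>n\<ge>N. Q n (Y n \<omega>)}) \<longlonglongrightarrow> 1"
proof -
  let ?A = "\<lambda>N. {\<omega> \<in> space M. \<forall>n\<ge>N. Q n (Y n \<omega>)}"
  have "?A N \<in> events" for N by measurable
  then have "(\<lambda>N. prob (?A N)) \<longlonglongrightarrow> prob (\<Union>N. ?A N)"
    by (intro finite_Lim_measure_incseq) (auto simp: incseq_def)
  moreover have "(\<Union>N. ?A N) = {\<omega> \<in> space M. eventually (\<lambda>n. Q n (Y n \<omega>)) sequentially}"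
    by (auto simp: eventually_sequentially)
  moreover have "prob {\<omega> \<in> space M. eventually (\<lambda>n. Q n (Y n \<omega>)) sequentially} = 1"
  proof (subst prob_Collect_eq_1)
    show "{\<omega> \<in> space M. eventually (\<lambda>n. Q n (Y n \<omega>)) sequentially} \<in> events"
      unfolding eventually_sequentially by measurable
  qed (rule assms)
  ultimately show ?thesis by simp
qed

text \<open>Positive speed means that the root is eventually left for ever. Without escape from a
  fresh first child, every reachable state would return to the root almost surely.\<close>

lemma escaping_if_speed:
  assumes "has_speed M Y S" "0 < S"
  shows "escaping {[0]} [0]"
proof (rule ccontr)
  assume not_esc: "\<not> escaping {[0]} [0]"
  have "AE \<omega> in M. eventually (\<lambda>n. Y n \<omega> \<noteq> []) sequentially"
    using assms(1) unfolding has_speed_def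
  proof eventually_elim
    case (elim \<omega>)
    then have "eventually (\<lambda>n. 0 < real (vertex_height (Y n \<omega>)) / real n) sequentially"
      using assms(2) by (rule order_tendstoD)
    then show ?case by eventually_elim (auto simp: vertex_height_def)
  qed
  then have "(\<lambda>N. prob {\<omega> \<in> space M. \<forall>n\<ge>N. Y n \<omega> \<noteq> []}) \<longlonglongrightarrow> 1"
    by (rule prob_eventually)
  then have "eventually (\<lambda>N. 1 / 2 < prob {\<omega> \<in> space M. \<forall>n\<ge>N. Y n \<omega> \<noteq> []}) sequentially"
    by (rule order_tendstoD) simp
  then obtain N where N: "1 / 2 < prob {\<omega> \<in> space M. \<forall>n\<ge>N. Y n \<omega> \<noteq> []}"
    by (auto simp: eventually_sequentially)
  have "(\<lambda>m. (avg ^^ N) (surv {0<..} m) {} []) \<longlonglongrightarrow> 0"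
    by (rule avg_funpow_tendsto_0[OF surv_tendsto_0[OF not_esc] good_start])
  moreover have "1 / 2 \<le> (avg ^^ N) (surv {0<..} m) {} []" for m
  proof -
    have "{\<omega> \<in> space M. \<forall>i. N \<le> i \<and> i \<le> N + m \<longrightarrow> Y i \<omega> \<noteq> []} \<in> events" by measurable
    then have "prob {\<omega> \<in> space M. \<forall>n\<ge>N. Y n \<omega> \<noteq> []}
        \<le> prob {\<omega> \<in> space M. \<forall>i. N \<le> i \<and> i \<le> N + m \<longrightarrow> Y i \<omega> \<noteq> []}"
      by (intro finite_measure_mono) auto
    then show ?thesis using N unfolding prob_avoids_root by simp
  qed
  ultimately have "(1 / 2 :: real) \<le> 0" by (intro LIMSEQ_le_const) auto
  then show False by simp
qed

lemma mass_below_speed: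
  assumes "has_speed M Y S" "0 < \<delta>"
  shows "(\<lambda>n. mass {h. real h < (S - \<delta>) * real n} n {} []) \<longlonglongrightarrow> 0"
proof -
  let ?Q = "\<lambda>n y. \<not> real (length y) < (S - \<delta>) * real n"
  have "AE \<omega> in M. eventually (\<lambda>n. ?Q n (Y n \<omega>)) sequentially"
    using assms(1) unfolding has_speed_def
  proof eventually_elim
    case (elim \<omega>)
    then have "eventually (\<lambda>n. S - \<delta> < real (vertex_height (Y n \<omega>)) / real n) sequentially"
      using assms(2) by (intro order_tendstoD) auto
    then show ?case using eventually_gt_at_top[of 0]
      by eventually_elim (simp add: vertex_height_def field_simps)
  qed
  then have "(\<lambda>N. prob {\<omega> \<in> space M. \<forall>n\<ge>N. ?Q n (Y n \<omega>)}) \<longlonglongrightarrow> 1"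
    by (rule prob_eventually)
  then have lim: "(\<lambda>N. 1 - prob {\<omega> \<in> space M. \<forall>n\<ge>N. ?Q n (Y n \<omega>)}) \<longlonglongrightarrow> 1 - 1"
    by (intro tendsto_diff tendsto_const)
  have "mass {h. real h < (S - \<delta>) * real N} N {} [] \<le> 1 - prob {\<omega> \<in> space M. \<forall>n\<ge>N. ?Q n (Y n \<omega>)}" for N
  proof -
    let ?A = "{\<omega> \<in> space M. \<forall>n\<ge>N. ?Q n (Y n \<omega>)}"
    have A: "?A \<in> events" by measurable
    have "mass {h. real h < (S - \<delta>) * real N} N {} [] = prob {\<omega> \<in> space M. real (length (Y N \<omega>)) < (S - \<delta>) * real N}"
      unfolding prob_height[symmetric] by simp
    also have "\<dots> \<le> prob (space M - ?A)" using A by (intro finite_measure_mono) auto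
    also have "\<dots> = 1 - prob ?A" using A by (rule prob_compl)
    finally show ?thesis .
  qed
  moreover have "(\<lambda>N. 1 - prob {\<omega> \<in> space M. \<forall>n\<ge>N. ?Q n (Y n \<omega>)}) \<longlonglongrightarrow> 0" using lim by simp
  ultimately show ?thesis by (rule tendsto_0_sandwich) (rule mass_nonneg)
qed

end

theorem theorem3:
  fixes M :: "'w measure" and b :: nat and c S \<epsilon> :: real
    and Y :: "nat \<Rightarrow> 'w \<Rightarrow> nat list"
  assumes "b \<ge> 2" and "c > 1"
    and "once_reinforced_walk M b c Y"
    and "has_speed M Y S"
    and "0 < \<epsilon>" and "\<epsilon> < S"
  shows "0 < liminf (\<lambda>n. ereal (-1 / real n) *
               elog \<P>(\<omega> in M. real (vertex_height (Y n \<omega>)) \<le> (S - \<epsilon>) * real n))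
    \<and> liminf (\<lambda>n. ereal (-1 / real n) *
               elog \<P>(\<omega> in M. real (vertex_height (Y n \<omega>)) \<le> (S - \<epsilon>) * real n))
      \<le> limsup (\<lambda>n. ereal (-1 / real n) *
               elog \<P>(\<omega> in M. real (vertex_height (Y n \<omega>)) \<le> (S - \<epsilon>) * real n))
    \<and> limsup (\<lambda>n. ereal (-1 / real n) *
               elog \<P>(\<omega> in M. real (vertex_height (Y n \<omega>)) \<le> (S - \<epsilon>) * real n)) < \<infinity>"
proof -
  interpret once_reinforced_walk M b c Y by (rule assms(3))
  interpret walk_on_tree M b c Y
    using assms by unfold_locales auto
  have S: "0 < S" using assms by linarith
  let ?p = "\<lambda>n. \<P>(\<omega> in M. real (vertex_height (Y n \<omega>)) \<le> (S - \<epsilon>) * real n)"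
  let ?a = "\<lambda>n. ereal (-1 / real n) * elog (?p n)"
  have p_eq: "?p n = mass {h. real h \<le> (S - \<epsilon>) * real n} n {} []" for n
    using prob_height[of n "{h. real h \<le> (S - \<epsilon>) * real n}"] by (simp add: vertex_height_def)
  obtain \<beta> where "0 < \<beta>" "\<And>n. \<beta> \<le> surv {0<..} n {[0]} [0]"
    using escaping_if_speed[OF assms(4) S] by (auto simp: escaping_def)
  then interpret escaping_tree b c \<beta> by unfold_locales
  obtain \<gamma> K where \<gamma>: "0 < \<gamma>" and K: "0 < K" and decay: "\<And>n. ?p n \<le> K * exp (- \<gamma> * real n)"
    unfolding p_eq using mass_exponential_decay[OF S mass_below_speed[OF assms(4)] assms(5,6)] by blast
  \<comment> \<open>Half of the rate \<open>\<gamma>\<close> is given up to absorb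
    \<open>ln K\<close> for large \<open>n\<close>.\<close>
  have "eventually (\<lambda>n. ereal (\<gamma> / 2) \<le> ?a n) sequentially"
    using eventually_ge_at_top[of "nat \<lceil>2 * ln K / \<gamma>\<rceil>"] eventually_gt_at_top[of 0]
  proof eventually_elim
    case (elim n)
    show ?case
    proof (cases "?p n \<le> 0")
      case True
      \<comment> \<open>At probability zero the logarithm is minus infinity, so the sequence takes
        the value plus infinity.\<close>
      then show ?thesis using elim by (simp add: elog_def)
    next
      case False
      then have "ln (?p n) \<le> ln (K * exp (- \<gamma> * real n))" using decay[of n] K by (subst ln_le_cancel_iff) auto
      also have "\<dots> = ln K - \<gamma> * real n" using K by (simp add: ln_mult)
      also have "\<dots> \<le> - (\<gamma> / 2 * real n)"
      proof -
        have "2 * ln K / \<gamma> \<le> real n" using elim(1) by linarith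
        then show ?thesis using \<gamma> by (simp add: field_simps)
      qed
      finally have "\<gamma> / 2 \<le> - ln (?p n) / real n" using elim(2) by (simp add: field_simps)
      then show ?thesis using False by (simp add: elog_def)
    qed
  qed
  then have "ereal (\<gamma> / 2) \<le> liminf ?a" by (rule Liminf_bounded)
  moreover have "(0::ereal) < ereal (\<gamma> / 2)" using \<gamma> by simp
  ultimately have lower: "0 < liminf ?a" by (rule order_less_le_trans[rotated])
  define \<pi> where "\<pi> = 1 / (c * (real b + 1))"
  have \<pi>: "0 < \<pi>" using assms(2) by (simp add: \<pi>_def)
  \<comment> \<open>From \<open>n \<ge> 1 / (S - \<epsilon>)\<close> on, heights at most 1 satisfy
    the constraint, so the oscillating walk counts.\<close>
  have "eventually (\<lambda>n. ?a n \<le> ereal (- ln \<pi>)) sequentially"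
    using eventually_ge_at_top[of "nat \<lceil>1 / (S - \<epsilon>)\<rceil>"] eventually_gt_at_top[of 0]
  proof eventually_elim
    case (elim n)
    have "1 / (S - \<epsilon>) \<le> real n" using elim(1) by linarith
    then have "1 \<le> (S - \<epsilon>) * real n" using assms(6) by (simp add: field_simps)
    then have "mass {..1} n {} [] \<le> ?p n" unfolding p_eq by (intro mass_mono) auto
    then have le: "\<pi> ^ n \<le> ?p n" using mass_ge_power[of "[]" n "{}"] by (simp only: \<pi>_def) simp
    then have pos: "0 < ?p n" using \<pi> by (meson less_le_trans zero_less_power)
    have "real n * ln \<pi> = ln (\<pi> ^ n)" using \<pi> by (simp add: ln_realpow)
    also have "\<dots> \<le> ln (?p n)" using le pos \<pi> by (subst ln_le_cancel_iff) auto
    finally have "- ln (?p n) / real n \<le> - ln \<pi>" using elim(2) by (simp add: field_simps)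
    then show ?case using pos by (simp add: elog_def)
  qed
  then have "limsup ?a \<le> ereal (- ln \<pi>)" by (rule Limsup_bounded)
  then have upper: "limsup ?a < \<infinity>" by auto
  have "liminf ?a \<le> limsup ?a" by (rule Liminf_le_Limsup) simp
  with lower upper show ?thesis by blast
qed

end
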